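(* Let $\mathbf X,\mathbf Y,\mathbf Z$ be represented spaces, and let $\mathbf Y$ be effectively traceable. Then the following operations are computable: \begin{enumerate} \item $\circ:\mathcal M(\mathbf Y,\mathbf Z)\times\mathcal M(\mathbf X,\mathbf Y)\to\mathcal M(\mathbf X,\mathbf Z)$, $(f,g)\mapsto f\circ g$; \item $\mathrm{Curry}:\mathcal M(\mathbf Y\times\mathbf X,\mathbf Z)\to\mathcal C(\mathbf Y,\mathcal M(\mathbf X,\mathbf Z))$, $\mathrm{Curry}(f)(y)(x):=f(y,x)$. \end{enumerate}
   Context: A represented space $\mathbf X=(X,\delta_X)$ is a set $X$ with a partial surjection $\delta_X:\subseteq\mathbb N^{\mathbb N}\to X$ (the symbol $\subseteq$ marks possibly partial functions). A multi-valued function $f:\subseteq\mathbf X\rightrightarrows\mathbf Y$ assigns to each $x\in\mathrm{dom}(f)\subseteq X$ a nonempty set $f(x)\subseteq Y$. Composition: $z\in(f\circ g)(x)$ iff $g(x)\subseteq\mathrm{dom}(f)$ and $z\in f(y)$ for some $y\in g(x)$ (with $x\in\mathrm{dom}(g)$). $F:\subseteq\mathbb N^{\mathbb N}\to\mathbb N^{\mathbb N}$ is a realizer of $f$ if $\delta_YF(p)\in f\delta_X(p)$ for all $p\in\mathrm{dom}(f\delta_X)$; $f$ is computable (continuous) if it has a computable (continuous) realizer. Products are represented by $\delta_{X\times Y}\langle p,q\rangle=(\delta_X(p),\delta_Y(q))$. Fix a universal Turing machine; $\Phi_p:\subseteq\mathbb N^{\mathbb N}\to\mathbb N^{\mathbb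 N}$ is defined by $\Phi_p(q)=r$ iff on input $\langle p,q\rangle$ the machine writes infinitely often on the output tape, producing $r$. $\mathcal C(\mathbf X,\mathbf Y)$ is the represented space of total continuous (single-valued) functions $f:X\to Y$, $p$ being a name of $f$ if $\Phi_p$ is a realizer of $f$. Let $\delta_X^{\mathrm{cyl}}\langle p,q\rangle:=\delta_X(p)$ and $\Phi_p^{\mathbf X,\mathbf Y}:=\delta_Y\circ\Phi_p\circ(\delta_X^{\mathrm{cyl}})^{-1}:\subseteq\mathbf X\rightrightarrows\mathbf Y$; explicitly, $x\in\mathrm{dom}(\Phi_p^{\mathbf X,\mathbf Y})$ iff $\Phi_p(q)$ is defined and in $\mathrm{dom}(\delta_Y)$ for all $q\in\langle\delta_X^{-1}\{x\}\times\mathbb N^{\mathbb N}\rangle$, and then $\Phi_p^{\mathbf X,\mathbf Y}(x)=\{\delta_Y\Phi_p(q):q\in\langle\delta_X^{-1}\{x\}\times\mathbb N^{\mathbb N}\rangle\}$. $\mathcal M(\mathbf X,\mathbf Y)$ is the represented space of all $\Phi_p^{\mathbf X,\mathbf Y}$ (strongly continuous multi-valued functions), $p$ being a name of $\Phi_p^{\mathbf X,\mathbf Y}$. A representation $\delta_X:\subseteq\mathbb N^{\mathbb N}\to X$ is effectively traceable if there is a computable $T:\subseteq\mathbb N^{\mathbb N}\times\mathbb N^{\mathbb N}\to\mathbb N^{\mathbb N}$ with $\mathrm{dom}(T)=\mathrm{dom}(\delta_X)\times\mathbb N^{\mathbb N}$ and $\{T(p,q):q\in\mathbb N^{\mathbb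 N}\}=\delta_X^{-1}(\delta_X(p))$ for all $p\in\mathrm{dom}(\delta_X)$. A represented space is effectively traceable if its representation is. *)

theory Defs
  imports "HOL-Analysis.Function_Topology" "HOL-Library.Sublist"
begin

section \<open>Turing machines on Baire space\<close>

type_synonym baire = "nat \<Rightarrow> nat"

text \<open>
  Every state of a machine carries one action, a machine is the finite list of the actions of its
  states, the initial state is 0, and a machine halts in a state beyond the end of the list.
  There are finitely many one-way reading heads on the read-only input tape (a work tape could store
  what a single head has read, so this does not affect the functions computed), finitely many
  two-way infinite work tapes over a binary alphabet with blank False, and a one-way write-only
  output tape.

  Action \<open>Read i s t\<close> consumes the next symbol under reading head \<open>i\<close> and continues in state \<open>s\<close> if
  that symbol is False and in \<open>t\<close> if it is True.  Action \<open>Work i f\<close> replaces the symbol \<open>b\<close> scanned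
  on work tape \<open>i\<close> as prescribed by \<open>f b\<close>, moves the head of that tape, and changes the state.
\<close>

datatype dir = Lft | Rgt

datatype action =
    Read nat nat nat
  | Print bool nat
  | Work nat "bool \<Rightarrow> bool \<times> dir \<times> nat"

type_synonym machine = "action list"

record config =
  ctrl :: nat
  rpos :: "nat \<Rightarrow> nat"
  tape :: "nat \<Rightarrow> int \<Rightarrow> bool"
  wpos :: "nat \<Rightarrow> int"
  outp :: "bool list"

definition init_config :: config where
  "init_config = \<lparr>ctrl = 0, rpos = (\<lambda>_. 0), tape = (\<lambda>_ _. False), wpos = (\<lambda>_. 0), outp = []\<rparr>"

fun act :: "(nat \<Rightarrow> bool) \<Rightarrow> action \<Rightarrow> config \<Rightarrow> config" where
  "act w (Read i s t) c =
     c\<lparr>ctrl := (if w (rpos c i) then t else s), rpos := (rpos c)(i := Suc (rpos c i))\<rparr>"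
| "act w (Print b s) c = c\<lparr>ctrl := s, outp := outp c @ [b]\<rparr>"
| "act w (Work i f) c =
     (case f (tape c i (wpos c i)) of (b, d, s) \<Rightarrow>
       c\<lparr>ctrl := s,
         tape := (tape c)(i := (tape c i)(wpos c i := b)),
         wpos := (wpos c)(i := (case d of Lft \<Rightarrow> wpos c i - 1 | Rgt \<Rightarrow> wpos c i + 1))\<rparr>)"

definition step :: "machine \<Rightarrow> (nat \<Rightarrow> bool) \<Rightarrow> config \<Rightarrow> config" where
  "step M w c = (if ctrl c < length M then act w (M ! ctrl c) c else c)"

definition run :: "machine \<Rightarrow> (nat \<Rightarrow> bool) \<Rightarrow> nat \<Rightarrow> config" where
  "run M w t = (step M w ^^ t) init_config"

text \<open>
  A sequence \<open>p\<close> of numbers is written on a tape in unary: the number \<open>k\<close> becomes \<open>k\<close> symbols True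
  followed by the delimiter False.
\<close>

definition unary :: "baire \<Rightarrow> nat \<Rightarrow> bool list" where
  "unary p n = concat (map (\<lambda>i. replicate (p i) True @ [False]) [0..<n])"

text \<open>Every block is nonempty, so the first \<open>k + 1\<close> blocks contain the symbol number \<open>k\<close>.\<close>

definition input :: "baire \<Rightarrow> nat \<Rightarrow> bool" where
  "input p k = unary p (Suc k) ! k"

definition produces :: "machine \<Rightarrow> baire \<Rightarrow> baire \<Rightarrow> bool" where
  "produces M p r \<longleftrightarrow> (\<forall>n. \<exists>t. prefix (unary r n) (outp (run M (input p) t)))"

text \<open>The domain consists of exactly those inputs on which infinitely many numbers are written.\<close>

definition sem :: "machine \<Rightarrow> baire \<rightharpoonup> baire" where
  "sem M p = (if \<exists>r. produces M p r then Some (THE r. produces M p r) else None)"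

text \<open>
  A computable partial function is one computed by a machine with precisely its domain, rather than
  a restriction of such a function.  For realizers the difference is immaterial, as they may be
  defined on more than the required names, but in the definition of effective traceability the
  prescribed domain becomes part of the computability requirement.
\<close>

definition computable_baire :: "(baire \<rightharpoonup> baire) \<Rightarrow> bool" where
  "computable_baire F \<longleftrightarrow> (\<exists>M. F = sem M)"

definition continuous_baire :: "(baire \<rightharpoonup> baire) \<Rightarrow> bool" where
  "continuous_baire F \<longleftrightarrow> continuous_on (dom F) (the \<circ> F)"

definition pair :: "baire \<Rightarrow> baire \<Rightarrow> baire" where
  "pair p q n = (if even n then p (n div 2) else q (n div 2))"

definition proj1 :: "baire \<Rightarrow> baire" where
  "proj1 r n = r (2 * n)"

definition proj2 :: "baire \<Rightarrow> baire" where
  "proj2 r n = r (2 * n + 1)"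

text \<open>
  A universal machine simulates any machine \<open>M\<close> after a computable translation \<open>S\<close> of the first
  component of its input, typically putting a program for \<open>M\<close> in front of it.  The equation is
  one between partial functions, so divergence is simulated as well.
\<close>

definition universal :: "machine \<Rightarrow> bool" where
  "universal U \<longleftrightarrow>
     (\<forall>M. \<exists>S. computable_baire (\<lambda>p. Some (S p)) \<and>
        (\<forall>p q. sem U (pair (S p) q) = sem M (pair p q)))"

definition Phi :: "machine \<Rightarrow> baire \<Rightarrow> baire \<rightharpoonup> baire" where
  "Phi U p q = sem U (pair p q)"


section \<open>Represented spaces\<close>

text \<open>
  A multi-valued function assigns the empty set to the points outside its domain.
\<close>

type_synonym ('a, 'b) multi = "'a \<Rightarrow> 'b set"

definition mdom :: "('a, 'b) multi \<Rightarrow> 'a set" where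
  "mdom f = {x. f x \<noteq> {}}"

definition mcomp :: "('b, 'c) multi \<Rightarrow> ('a, 'b) multi \<Rightarrow> ('a, 'c) multi"  (infixl "\<circ>\<^sub>M" 55) where
  "(f \<circ>\<^sub>M g) x = {z. x \<in> mdom g \<and> g x \<subseteq> mdom f \<and> (\<exists>y\<in>g x. z \<in> f y)}"

definition mv :: "('a \<rightharpoonup> 'b) \<Rightarrow> ('a, 'b) multi" where
  "mv f x = set_option (f x)"

definition minv :: "('a \<rightharpoonup> 'b) \<Rightarrow> ('b, 'a) multi" where
  "minv f y = {x. f x = Some y}"

text \<open>
  The space represented by \<open>\<delta>\<close> has the underlying set \<open>ran \<delta>\<close>, so \<open>\<delta>\<close> is surjective by
  construction.
\<close>

type_synonym 'a rep = "baire \<rightharpoonup> 'a"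

definition prod_rep :: "'a rep \<Rightarrow> 'b rep \<Rightarrow> ('a \<times> 'b) rep"  (infixr "\<times>\<^sub>r" 80) where
  "(\<delta>X \<times>\<^sub>r \<delta>Y) r =
     (case (\<delta>X (proj1 r), \<delta>Y (proj2 r)) of (Some x, Some y) \<Rightarrow> Some (x, y) | _ \<Rightarrow> None)"

definition cyl :: "'a rep \<Rightarrow> 'a rep" where
  "cyl \<delta> r = \<delta> (proj1 r)"

definition realizes :: "'a rep \<Rightarrow> 'b rep \<Rightarrow> (baire \<rightharpoonup> baire) \<Rightarrow> ('a, 'b) multi \<Rightarrow> bool" where
  "realizes \<delta>X \<delta>Y F f \<longleftrightarrow>
     (\<forall>p x. \<delta>X p = Some x \<and> x \<in> mdom f \<longrightarrow>
        (\<exists>q y. F p = Some q \<and> \<delta>Y q = Some y \<and> y \<in> f x))"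

definition computable_multi :: "'a rep \<Rightarrow> 'b rep \<Rightarrow> ('a, 'b) multi \<Rightarrow> bool" where
  "computable_multi \<delta>X \<delta>Y f \<longleftrightarrow> (\<exists>F. computable_baire F \<and> realizes \<delta>X \<delta>Y F f)"

definition continuous_multi :: "'a rep \<Rightarrow> 'b rep \<Rightarrow> ('a, 'b) multi \<Rightarrow> bool" where
  "continuous_multi \<delta>X \<delta>Y f \<longleftrightarrow> (\<exists>F. continuous_baire F \<and> realizes \<delta>X \<delta>Y F f)"

text \<open>A total function on a represented space is a partial map with domain \<open>ran \<delta>X\<close>.\<close>

definition cont_name :: "machine \<Rightarrow> 'a rep \<Rightarrow> 'b rep \<Rightarrow> baire \<Rightarrow> ('a \<rightharpoonup> 'b) \<Rightarrow> bool" where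
  "cont_name U \<delta>X \<delta>Y p f \<longleftrightarrow>
     dom f = ran \<delta>X \<and> ran f \<subseteq> ran \<delta>Y \<and> continuous_multi \<delta>X \<delta>Y (mv f) \<and>
     realizes \<delta>X \<delta>Y (Phi U p) (mv f)"

definition C_rep :: "machine \<Rightarrow> 'a rep \<Rightarrow> 'b rep \<Rightarrow> ('a \<rightharpoonup> 'b) rep" where
  "C_rep U \<delta>X \<delta>Y p =
     (if \<exists>f. cont_name U \<delta>X \<delta>Y p f then Some (THE f. cont_name U \<delta>X \<delta>Y p f) else None)"

definition Phi_multi :: "machine \<Rightarrow> 'a rep \<Rightarrow> 'b rep \<Rightarrow> baire \<Rightarrow> ('a, 'b) multi" where
  "Phi_multi U \<delta>X \<delta>Y p = mv \<delta>Y \<circ>\<^sub>M mv (Phi U p) \<circ>\<^sub>M minv (cyl \<delta>X)"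

definition M_rep :: "machine \<Rightarrow> 'a rep \<Rightarrow> 'b rep \<Rightarrow> ('a, 'b) multi rep" where
  "M_rep U \<delta>X \<delta>Y p = Some (Phi_multi U \<delta>X \<delta>Y p)"

definition effectively_traceable :: "'a rep \<Rightarrow> bool" where
  "effectively_traceable \<delta> \<longleftrightarrow>
     (\<exists>T :: baire \<times> baire \<rightharpoonup> baire.
        computable_baire (\<lambda>r. T (proj1 r, proj2 r)) \<and>
        dom T = dom \<delta> \<times> UNIV \<and>
        (\<forall>p\<in>dom \<delta>. {the (T (p, q)) | q. True} = {r. \<delta> r = \<delta> p}))"

definition Curry :: "'b rep \<Rightarrow> ('b \<times> 'a, 'c) multi \<Rightarrow> 'b \<rightharpoonup> ('a, 'c) multi" where
  "Curry \<delta>Y f y = (if y \<in> ran \<delta>Y then Some (\<lambda>x. f (y, x)) else None)"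


section \<open>Well-definedness\<close>

lemma proj_pair [simp]: "proj1 (pair p q) = p" "proj2 (pair p q) = q"
  by (auto simp: proj1_def proj2_def pair_def)

lemma pair_proj [simp]: "pair (proj1 r) (proj2 r) = r"
  by (auto simp: proj1_def proj2_def pair_def fun_eq_iff)

lemma unary_Suc: "unary p (Suc n) = unary p n @ replicate (p n) True @ [False]"
  by (simp add: unary_def)

lemma length_unary: "n \<le> length (unary p n)"
  by (induction n) (auto simp: unary_Suc unary_def)

lemma replicate_block:
  assumes "replicate a True @ False # xs = replicate b True @ False # ys"
  shows "a = b \<and> xs = ys"
  using assms
proof (induction a arbitrary: b)
  case 0
  then show ?case by (cases b) auto
next
  case (Suc a)
  then show ?case by (cases b) auto
qed

lemma unary_inj:
  assumes "unary p n @ xs = unary q n @ ys"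
  shows "(\<forall>i<n. p i = q i) \<and> xs = ys"
  using assms
proof (induction n arbitrary: xs ys)
  case 0
  then show ?case by (simp add: unary_def)
next
  case (Suc n)
  from Suc.prems have "unary p n @ (replicate (p n) True @ False # xs)
           = unary q n @ (replicate (q n) True @ False # ys)"
    by (simp add: unary_Suc)
  from Suc.IH[OF this] have *: "\<forall>i<n. p i = q i"
    and eq: "replicate (p n) True @ False # xs = replicate (q n) True @ False # ys"
    by auto
  from * replicate_block[OF eq] show ?case
    by (auto simp: less_Suc_eq)
qed

lemma outp_step: "prefix (outp c) (outp (step M w c))"
proof (cases "M ! ctrl c")
  case (Work i f)
  then show ?thesis by (cases "f (tape c i (wpos c i))") (auto simp: step_def)
qed (auto simp: step_def)

lemma outp_run_mono: "s \<le> t \<Longrightarrow> prefix (outp (run M w s)) (outp (run M w t))"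
proof (induction rule: dec_induct)
  case (step n)
  have "prefix (outp (run M w n)) (outp (run M w (Suc n)))"
    by (simp add: run_def outp_step)
  with step.IH show ?case by (rule prefix_order.trans)
qed simp

lemma produces_unique:
  assumes "produces M p r" "produces M p r'"
  shows "r = r'"
proof
  fix n
  obtain s t where s: "prefix (unary r (Suc n)) (outp (run M (input p) s))"
    and t: "prefix (unary r' (Suc n)) (outp (run M (input p) t))"
    using assms unfolding produces_def by blast
  let ?o = "outp (run M (input p) (max s t))"
  have "prefix (unary r (Suc n)) ?o" "prefix (unary r' (Suc n)) ?o"
    using prefix_order.trans[OF s outp_run_mono[of s "max s t"]]
      prefix_order.trans[OF t outp_run_mono[of t "max s t"]] by simp_all
  then obtain xs ys where "unary r (Suc n) @ xs = unary r' (Suc n) @ ys"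
    by (metis prefixE)
  from unary_inj[OF this] show "r n = r' n"
    by simp
qed

lemma sem_eq_Some: "sem M p = Some r \<longleftrightarrow> produces M p r"
proof -
  have "(THE r'. produces M p r') = r" if "produces M p r" for r
    using that produces_unique by (intro the_equality)
  then show ?thesis unfolding sem_def by (metis option.distinct(1) option.inject)
qed

lemma cont_name_unique:
  assumes "cont_name U \<delta>X \<delta>Y p f" "cont_name U \<delta>X \<delta>Y p g"
  shows "f = g"
proof
  fix x
  show "f x = g x"
  proof (cases "x \<in> ran \<delta>X")
    case True
    then obtain q where q: "\<delta>X q = Some x" by (auto simp: ran_def)
    from True assms have "x \<in> dom f" "x \<in> dom g"
      by (simp_all add: cont_name_def)
    then obtain y z where yz: "f x = Some y" "g x = Some z"
      by blast
    have "realizes \<delta>X \<delta>Y (Phi U p) (mv f)" "realizes \<delta>X \<delta>Y (Phi U p) (mv g)"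
      using assms by (simp_all add: cont_name_def)
    with q yz have "\<exists>r. Phi U p q = Some r \<and> \<delta>Y r = Some y" "\<exists>r. Phi U p q = Some r \<and> \<delta>Y r = Some z"
      by (auto simp: realizes_def mdom_def mv_def dest!: spec[of _ q] spec[of _ x])
    with yz show ?thesis
      by auto
  next
    case False
    then have "x \<notin> dom f" "x \<notin> dom g"
      using assms by (simp_all add: cont_name_def)
    then show ?thesis
      by (simp add: domIff)
  qed
qed

lemma C_rep_eq_Some: "C_rep U \<delta>X \<delta>Y p = Some f \<longleftrightarrow> cont_name U \<delta>X \<delta>Y p f"
proof -
  have "(THE g. cont_name U \<delta>X \<delta>Y p g) = f" if "cont_name U \<delta>X \<delta>Y p f" for f
    using that cont_name_unique by (intro the_equality)
  then show ?thesis unfolding C_rep_def by (metis option.distinct(1) option.inject)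
qed

lemma mdom_Phi_multi:
  "x \<in> mdom (Phi_multi U \<delta>X \<delta>Y p) \<longleftrightarrow>
     x \<in> ran \<delta>X \<and>
     (\<forall>q s. \<delta>X q = Some x \<longrightarrow> (\<exists>r. Phi U p (pair q s) = Some r \<and> r \<in> dom \<delta>Y))"
    (is "?L \<longleftrightarrow> ?R")
proof
  assume ?L
  then obtain z where z: "z \<in> Phi_multi U \<delta>X \<delta>Y p x"
    by (auto simp: mdom_def)
  then obtain q where "cyl \<delta>X q = Some x"
    by (auto simp: Phi_multi_def mcomp_def minv_def)
  then have "x \<in> ran \<delta>X"
    by (auto simp: cyl_def ran_def)
  moreover have "\<exists>r. Phi U p (pair q s) = Some r \<and> r \<in> dom \<delta>Y" if q: "\<delta>X q = Some x" for q s
  proof -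
    have in_minv: "pair q s \<in> minv (cyl \<delta>X) x"
      using q by (simp add: minv_def cyl_def)
    from z have "minv (cyl \<delta>X) x \<subseteq> mdom (mv \<delta>Y \<circ>\<^sub>M mv (Phi U p))"
      by (simp add: Phi_multi_def mcomp_def)
    with in_minv have "pair q s \<in> mdom (mv \<delta>Y \<circ>\<^sub>M mv (Phi U p))"
      by blast
    then show ?thesis
      by (auto simp: mdom_def mcomp_def mv_def)
  qed
  ultimately show ?R by blast
next
  assume R: ?R
  then obtain q where q: "\<delta>X q = Some x"
    by (auto simp: ran_def)
  have sub: "minv (cyl \<delta>X) x \<subseteq> mdom (mv \<delta>Y \<circ>\<^sub>M mv (Phi U p))"
  proof
    fix u assume "u \<in> minv (cyl \<delta>X) x"
    then have "\<delta>X (proj1 u) = Some x"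
      by (simp add: minv_def cyl_def)
    with R obtain r y where "Phi U p (pair (proj1 u) (proj2 u)) = Some r" "\<delta>Y r = Some y"
      by blast
    then show "u \<in> mdom (mv \<delta>Y \<circ>\<^sub>M mv (Phi U p))"
      by (simp add: mdom_def mcomp_def mv_def)
  qed
  have q': "pair q q \<in> minv (cyl \<delta>X) x"
    using q by (simp add: minv_def cyl_def)
  with sub obtain z where "z \<in> (mv \<delta>Y \<circ>\<^sub>M mv (Phi U p)) (pair q q)"
    by (auto simp: mdom_def)
  with sub q' have "z \<in> Phi_multi U \<delta>X \<delta>Y p x"
    unfolding Phi_multi_def by (subst mcomp_def) (auto simp: mdom_def)
  then show ?L
    by (auto simp: mdom_def)
qed

lemma Phi_multi_eq:
  assumes "x \<in> mdom (Phi_multi U \<delta>X \<delta>Y p)"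
  shows "Phi_multi U \<delta>X \<delta>Y p x =
     {the (\<delta>Y (the (Phi U p (pair q s)))) | q s. \<delta>X q = Some x}"
proof (intro equalityI subsetI)
  fix z assume "z \<in> Phi_multi U \<delta>X \<delta>Y p x"
  then obtain u where u: "\<delta>X (proj1 u) = Some x" "z \<in> (mv \<delta>Y \<circ>\<^sub>M mv (Phi U p)) u"
    by (auto simp: Phi_multi_def mcomp_def[of _ "minv _"] minv_def cyl_def)
  from u(2) obtain r where "Phi U p u = Some r" "\<delta>Y r = Some z"
    by (auto simp: mcomp_def mv_def)
  then have "z = the (\<delta>Y (the (Phi U p (pair (proj1 u) (proj2 u)))))"
    by simp
  with u(1) show "z \<in> {the (\<delta>Y (the (Phi U p (pair q s)))) | q s. \<delta>X q = Some x}"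
    by blast
next
  fix z assume "z \<in> {the (\<delta>Y (the (Phi U p (pair q s)))) | q s. \<delta>X q = Some x}"
  then obtain q s where q: "\<delta>X q = Some x" and z: "z = the (\<delta>Y (the (Phi U p (pair q s))))"
    by blast
  from assms q obtain r y where r: "Phi U p (pair q s) = Some r" "\<delta>Y r = Some y"
    unfolding mdom_Phi_multi by blast
  from r z have "z \<in> (mv \<delta>Y \<circ>\<^sub>M mv (Phi U p)) (pair q s)"
    by (simp add: mcomp_def mv_def mdom_def)
  moreover have "pair q s \<in> minv (cyl \<delta>X) x"
    using q by (simp add: minv_def cyl_def)
  moreover have "x \<in> mdom (minv (cyl \<delta>X))" "minv (cyl \<delta>X) x \<subseteq> mdom (mv \<delta>Y \<circ>\<^sub>M mv (Phi U p))"
    using assms by (auto simp: Phi_multi_def mdom_def[of "_ \<circ>\<^sub>M minv _"] mcomp_def[of _ "minv _"])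
  ultimately show "z \<in> Phi_multi U \<delta>X \<delta>Y p x"
    unfolding Phi_multi_def mcomp_def[of _ "minv _"] by blast
qed

end

theory Submission
  imports Defs "HOL-Library.Nat_Bijection"
begin

text \<open>
  Both operations are obtained from the universal machine by translating a single partial
  computable function.  A name of \<open>f \<circ> g\<close> is to map \<open>\<langle>q, \<langle>s1, \<langle>s2, s3\<rangle>\<rangle>\<rangle>\<close> to
  \<open>\<Phi>\<^sub>f\<langle>T(\<Phi>\<^sub>g\<langle>q, s1\<rangle>, s2), s3\<rangle>\<close>, and a name of \<open>Curry(f)(y)\<close>, for a name \<open>t\<close> of \<open>y\<close>, is to map
  \<open>\<langle>q, \<langle>s1, s2\<rangle>\<rangle>\<close> to \<open>\<Phi>\<^sub>f\<langle>\<langle>T(t, s1), q\<rangle>, s2\<rangle>\<close>.  The trace \<open>T\<close> runs through all names of the point of \<open>Y\<close>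
  as the cylinder component varies, so the values and the domain come out exactly.

  The domain requires strict composition of machines.  A master machine reads the output of
  another machine without storing it: every head of the master owns a private copy of that machine
  as a coroutine, which is resumed whenever the head needs a symbol.  Strictness is enforced by a
  further copy that has to write the delimiter once for each symbol of the final output.
\<close>

section \<open>Machines on several, possibly finite, streams\<close>

text \<open>Every head \<open>i\<close> has a stream \<open>v i\<close> of its own, so that
  different machines can later be attached to different heads. An ordinary run is the case of one
  total stream shared by all heads.\<close>

type_synonym streams = "nat \<Rightarrow> nat \<Rightarrow> bool option"

text \<open>A stream may end (None); a read beyond its end blocks the machine forever.\<close>

definition pact :: "streams \<Rightarrow> action \<Rightarrow> config \<Rightarrow> config" where
  "pact v a c =
     (case a of
        Read i s t \<Rightarrow> (case v i (rpos c i) of None \<Rightarrow> c | Some b \<Rightarrow> act (\<lambda>_. b) a c)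
      | _ \<Rightarrow> act (\<lambda>_. False) a c)"

definition pstep :: "machine \<Rightarrow> streams \<Rightarrow> config \<Rightarrow> config" where
  "pstep M v c = (if ctrl c < length M then pact v (M ! ctrl c) c else c)"

definition prun :: "machine \<Rightarrow> streams \<Rightarrow> nat \<Rightarrow> config" where
  "prun M v t = (pstep M v ^^ t) init_config"

text \<open>The limit of the output is again a possibly finite stream, hence a legal input for
  another machine. The choice of \<open>t\<close> is harmless because written symbols never
  change.\<close>

definition pout :: "machine \<Rightarrow> streams \<Rightarrow> nat \<Rightarrow> bool option" where
  "pout M v n =
     (if \<exists>t. n < length (outp (prun M v t))
      then Some (outp (prun M v (SOME t. n < length (outp (prun M v t)))) ! n) else None)"

definition emb :: "baire \<Rightarrow> nat \<Rightarrow> bool option" where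
  "emb p k = Some (input p k)"

lemma prun_0 [simp]: "prun M v 0 = init_config"
  by (simp add: prun_def)

lemma prun_Suc [simp]: "prun M v (Suc t) = pstep M v (prun M v t)"
  by (simp add: prun_def)

lemma init_config_sel [simp]:
  "ctrl init_config = 0" "rpos init_config i = 0" "tape init_config i = (\<lambda>_. False)"
  "wpos init_config i = 0" "outp init_config = []"
  by (simp_all add: init_config_def)

lemma pact_Read [simp]:
  "pact v (Read i s t) c =
     (case v i (rpos c i) of None \<Rightarrow> c
      | Some b \<Rightarrow> c\<lparr>ctrl := (if b then t else s), rpos := (rpos c)(i := Suc (rpos c i))\<rparr>)"
  by (simp add: pact_def split: option.split)

lemma pact_Print [simp]: "pact v (Print b s) c = c\<lparr>ctrl := s, outp := outp c @ [b]\<rparr>"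
  by (simp add: pact_def)

lemma pact_Work [simp]: "pact v (Work i f) c = act w (Work i f) c"
  by (simp add: pact_def)

lemma prun_emb: "prun M (\<lambda>_ k. Some (w k)) t = run M w t"
proof (induction t)
  case (Suc t)
  have "pact (\<lambda>_ k. Some (w k)) a c = act w a c" for a c
    by (cases a) (simp_all add: pact_def)
  with Suc show ?case
    by (simp add: run_def pstep_def step_def)
qed (simp add: run_def)

lemma outp_pstep: "prefix (outp c) (outp (pstep M v c))"
proof (cases "M ! ctrl c")
  case (Work i f)
  then show ?thesis
    by (cases "f (tape c i (wpos c i))") (auto simp: pstep_def pact_def)
qed (auto simp: pstep_def split: option.split)

lemma outp_prun_mono: "s \<le> t \<Longrightarrow> prefix (outp (prun M v s)) (outp (prun M v t))"
proof (induction rule: dec_induct)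
  case (step n)
  with outp_pstep show ?case by (metis prun_Suc prefix_order.trans)
qed simp

lemma outp_prun_nth:
  assumes "n < length (outp (prun M v s))" "n < length (outp (prun M v t))"
  shows "outp (prun M v s) ! n = outp (prun M v t) ! n"
  using assms outp_prun_mono[of s t M v] outp_prun_mono[of t s M v]
  by (cases "s \<le> t") (auto simp: prefix_def nth_append)

lemma pout_eq_Some:
  "pout M v n = Some b \<longleftrightarrow>
     (\<exists>t. n < length (outp (prun M v t)) \<and> outp (prun M v t) ! n = b)"
proof -
  have "outp (prun M v (SOME t. n < length (outp (prun M v t)))) ! n = outp (prun M v t) ! n"
    if "n < length (outp (prun M v t))" for t
    using that by (intro outp_prun_nth) (rule someI)
  then show ?thesis
    by (auto simp: pout_def)
qed

text \<open>Only the outputs that occur matter, not when they occur, so a simulation may run at a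
  different speed.\<close>

lemma pout_eqI:
  assumes "\<And>t. \<exists>t'. outp (prun M v t) = outp (prun M' v' t')"
    and "\<And>t. \<exists>t'. outp (prun M' v' t) = outp (prun M v t')"
  shows "pout M v = pout M' v'"
proof
  fix n
  have "pout M v n = Some b \<longleftrightarrow> pout M' v' n = Some b" for b
    unfolding pout_eq_Some using assms by metis
  then show "pout M v n = pout M' v' n"
    by (metis not_None_eq)
qed

section \<open>Plugging coroutines into heads\<close>

definition clamp :: "machine \<Rightarrow> nat \<Rightarrow> nat" where
  "clamp M q = min q (length M)"

lemma clamp_less [simp]: "clamp M q < length M \<longleftrightarrow> q < length M"
  by (auto simp: clamp_def)

lemma clamp_nth [simp]: "q < length M \<Longrightarrow> clamp M q = q"
  by (auto simp: clamp_def)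

lemma clamp_le [simp]: "clamp M q \<le> length M"
  by (auto simp: clamp_def)

text \<open>
  In the combined machine, head \<open>j\<close> of coroutine \<open>i\<close> becomes head \<open>(i, j)\<close>, tape \<open>j\<close> of the master
  becomes tape \<open>(1, j)\<close>, and tape \<open>j\<close> of coroutine \<open>i\<close> becomes tape \<open>(i + 2, j)\<close>.  Tape \<open>(0, 0)\<close> only
  serves to change the state without any other effect.  Halting becomes an idle loop, and clamping
  control states to the length of the program keeps the combined state space finite.
\<close>

definition idle :: "nat \<Rightarrow> action" where
  "idle s = Work (prod_encode (0, 0)) (\<lambda>b. (b, Rgt, s))"

text \<open>Coroutine \<open>i\<close> moves exactly while the master waits at a read of head
  \<open>i\<close>. A symbol it prints is not stored: the printing step selects the successor
  \<open>q0\<close> or \<open>q1\<close> of the master at once.\<close>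

definition plug_act ::
    "machine \<Rightarrow> (nat \<Rightarrow> machine) \<Rightarrow> (nat \<times> (nat \<Rightarrow> nat) \<Rightarrow> nat) \<Rightarrow> nat \<times> (nat \<Rightarrow> nat) \<Rightarrow> action" where
  "plug_act M K e s = (case s of (q, g) \<Rightarrow>
     if q < length M then
       (case M ! q of
          Print b q' \<Rightarrow> Print b (e (clamp M q', g))
        | Work j f \<Rightarrow> Work (prod_encode (1, j)) (\<lambda>b. case f b of (b', d, q') \<Rightarrow> (b', d, e (clamp M q', g)))
        | Read i q0 q1 \<Rightarrow>
            if g i < length (K i) then
              (case K i ! g i of
                 Print b r \<Rightarrow> idle (e (clamp M (if b then q1 else q0), g(i := clamp (K i) r)))
               | Work j f \<Rightarrow> Work (prod_encode (i + 2, j))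
                    (\<lambda>b. case f b of (b', d, r) \<Rightarrow> (b', d, e (q, g(i := clamp (K i) r))))
               | Read j r0 r1 \<Rightarrow> Read (prod_encode (i, j))
                    (e (q, g(i := clamp (K i) r0))) (e (q, g(i := clamp (K i) r1))))
            else idle (e (q, g)))
     else idle (e (q, g)))"

text \<open>Coroutines from \<open>k\<close> on are never resumed and stay in state 0, which makes
  this set of infinite tuples finite.\<close>

definition plug_states :: "machine \<Rightarrow> (nat \<Rightarrow> machine) \<Rightarrow> nat \<Rightarrow> (nat \<times> (nat \<Rightarrow> nat)) set" where
  "plug_states M K k = {..length M} \<times> {g. \<forall>i. g i \<le> (if i < k then length (K i) else 0)}"

lemma finite_plug_states: "finite (plug_states M K k)"
proof -
  define B where "B = Max (insert 0 ((length \<circ> K) ` {..<k}))"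
  have B: "length (K i) \<le> B" if "i < k" for i
    unfolding B_def using that by (intro Max_ge) auto
  have "{g. \<forall>i. g i \<le> (if i < k then length (K i) else 0)}
      \<subseteq> {g. \<forall>i. (i \<in> {..<k} \<longrightarrow> g i \<in> {..B}) \<and> (i \<notin> {..<k} \<longrightarrow> g i = 0)}"
    using B by (auto split: if_splits) (metis le_trans)+
  moreover have "finite {g :: nat \<Rightarrow> nat. \<forall>i. (i \<in> {..<k} \<longrightarrow> g i \<in> {..B}) \<and> (i \<notin> {..<k} \<longrightarrow> g i = 0)}"
    by (intro finite_set_of_finite_funs) auto
  ultimately show ?thesis
    unfolding plug_states_def by (intro finite_SigmaI finite_atMost) (rule finite_subset)
qed

text \<open>\<open>e\<close> numbers the combined states and \<open>N\<close> is the resulting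
  program. All heads of all coroutines read the stream \<open>s\<close>. The assumptions do not
  mention \<open>s\<close>, so one \<open>N\<close> serves every stream.\<close>

locale plugging =
  fixes M :: machine and K :: "nat \<Rightarrow> machine" and k :: nat and e :: "nat \<times> (nat \<Rightarrow> nat) \<Rightarrow> nat"
    and N :: machine and s :: "nat \<Rightarrow> bool option"
  assumes heads: "\<And>q i q0 q1. q < length M \<Longrightarrow> M ! q = Read i q0 q1 \<Longrightarrow> i < k"
    and e_init: "e (0, \<lambda>_. 0) = 0"
    and e: "\<And>x. x \<in> plug_states M K k \<Longrightarrow> e x < length N \<and> N ! e x = plug_act M K e x"
begin

definition rel :: "config \<Rightarrow> (nat \<Rightarrow> config) \<Rightarrow> config \<Rightarrow> bool" where
  "rel c d C \<longleftrightarrow>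
     ctrl C = e (clamp M (ctrl c), \<lambda>i. clamp (K i) (ctrl (d i))) \<and>
     (\<forall>i j. rpos C (prod_encode (i, j)) = rpos (d i) j) \<and>
     (\<forall>j. tape C (prod_encode (1, j)) = tape c j \<and> wpos C (prod_encode (1, j)) = wpos c j) \<and>
     (\<forall>i j. tape C (prod_encode (i + 2, j)) = tape (d i) j \<and>
            wpos C (prod_encode (i + 2, j)) = wpos (d i) j) \<and>
     outp C = outp c \<and>
     (\<forall>i. rpos c i = length (outp (d i))) \<and>
     (\<forall>i\<ge>k. ctrl (d i) = 0)"

abbreviation "sub i \<equiv> prun (K i) (\<lambda>_. s)"
abbreviation "v \<equiv> \<lambda>i. pout (K i) (\<lambda>_. s)"
abbreviation "reads c i \<equiv> ctrl c < length M \<and> (\<exists>q0 q1. M ! ctrl c = Read i q0 q1)"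
abbreviation "prints i c \<equiv> ctrl c < length (K i) \<and> (\<exists>b r. K i ! ctrl c = Print b r)"

lemma rel_init: "rel init_config (\<lambda>_. init_config) init_config"
  by (auto simp: rel_def e_init clamp_def)

lemma pstep_rel:
  assumes "rel c d C"
  shows "pstep N (\<lambda>_. s) C
    = pact (\<lambda>_. s) (plug_act M K e (clamp M (ctrl c), \<lambda>i. clamp (K i) (ctrl (d i)))) C"
proof -
  have "(clamp M (ctrl c), \<lambda>i. clamp (K i) (ctrl (d i))) \<in> plug_states M K k"
    using assms by (auto simp: plug_states_def rel_def clamp_def)
  with assms e show ?thesis
    by (simp add: pstep_def rel_def)
qed

lemma step_master:
  assumes "rel c d C" and "\<And>i. \<not> reads c i"
  shows "rel (pstep M v' c) d (pstep N (\<lambda>_. s) C)"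
proof (cases "ctrl c < length M")
  case False
  then show ?thesis
    using assms(1) unfolding pstep_rel[OF assms(1)]
    by (auto simp: plug_act_def idle_def pact_def pstep_def rel_def)
next
  case True
  show ?thesis
  proof (cases "M ! ctrl c")
    case (Print b q)
    then show ?thesis
      using assms(1) True unfolding pstep_rel[OF assms(1)]
      by (auto simp: plug_act_def pstep_def rel_def)
  next
    case (Work j f)
    then show ?thesis
      using assms(1) True unfolding pstep_rel[OF assms(1)]
      by (auto simp: plug_act_def pact_def pstep_def rel_def split: prod.splits dir.splits)
  qed (use True assms in auto)
qed

text \<open>The master is frozen while its coroutine works. If the coroutine has halted or is
  blocked at the end of \<open>s\<close>, the combined machine makes no progress either.\<close>

lemma step_sub:
  assumes "rel c d C" and "reads c i" and "\<not> prints i (d i)"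
  shows "rel c (d(i := pstep (K i) (\<lambda>_. s) (d i))) (pstep N (\<lambda>_. s) C)"
proof -
  from assms(2) obtain q0 q1 where M: "ctrl c < length M" "M ! ctrl c = Read i q0 q1"
    by blast
  with heads have i: "i < k"
    by blast
  show ?thesis
  proof (cases "ctrl (d i) < length (K i)")
    case False
    then show ?thesis
      using assms(1) M unfolding pstep_rel[OF assms(1)]
      by (auto simp: plug_act_def idle_def pact_def pstep_def rel_def)
  next
    case True
    show ?thesis
    proof (cases "K i ! ctrl (d i)")
      case (Print b r)
      with True assms show ?thesis by blast
    next
      case (Work j f)
      then show ?thesis
        using assms(1) True M i unfolding pstep_rel[OF assms(1)]
        by (auto simp: plug_act_def pact_def pstep_def rel_def fun_upd_def fun_eq_iff
            intro!: arg_cong[where f = e] split: prod.splits dir.splits)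
    next
      case (Read j r0 r1)
      then show ?thesis
        using assms(1) True M i unfolding pstep_rel[OF assms(1)]
        by (auto simp: plug_act_def pact_def pstep_def rel_def fun_upd_def fun_eq_iff
            intro!: arg_cong[where f = e] split: option.splits)
    qed
  qed
qed

text \<open>A print of the coroutine and a read of the master are one step of \<open>N\<close>. The
  assumption on \<open>d i\<close> identifies the printed symbol with the one that
  \<open>v i\<close> holds at the position of the head.\<close>

lemma step_deliver:
  assumes "rel c d C" and "reads c i" and "prints i (d i)" and d: "d i = sub i \<tau>"
  shows "rel (pstep M v c) (d(i := pstep (K i) (\<lambda>_. s) (d i))) (pstep N (\<lambda>_. s) C)"
proof -
  from assms(2) obtain q0 q1 where M: "ctrl c < length M" "M ! ctrl c = Read i q0 q1"
    by blast
  with heads have i: "i < k"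
    by blast
  from assms(3) obtain b r where K: "ctrl (d i) < length (K i)" "K i ! ctrl (d i) = Print b r"
    by blast
  have "outp (sub i (Suc \<tau>)) = outp (d i) @ [b]"
    using K by (simp add: d pstep_def)
  then have "v i (length (outp (d i))) = Some b"
    unfolding pout_eq_Some by (intro exI[of _ "Suc \<tau>"]) (simp add: nth_append)
  then have "v i (rpos c i) = Some b"
    using assms(1) by (simp add: rel_def)
  then show ?thesis
    using assms(1) K M i unfolding pstep_rel[OF assms(1)]
    by (auto simp: plug_act_def idle_def pact_def pstep_def rel_def fun_eq_iff
            intro!: arg_cong[where f = e])
qed

lemma sub_upd: "(\<lambda>i. sub i (T i))(i := pstep (K i) (\<lambda>_. s) (sub i (T i)))
    = (\<lambda>j. sub j ((T(i := Suc (T i))) j))"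
  by auto

text \<open>Each step of \<open>N\<close> advances the master, one coroutine, or both.
  \<open>T i\<close> is the local clock of coroutine \<open>i\<close>.\<close>

lemma sound: "\<exists>t T. rel (prun M v t) (\<lambda>i. sub i (T i)) (prun N (\<lambda>_. s) n)"
proof (induction n)
  case 0
  show ?case using rel_init by (intro exI[of _ 0] exI[of _ "\<lambda>_. 0"]) simp
next
  case (Suc n)
  then obtain t T where r: "rel (prun M v t) (\<lambda>i. sub i (T i)) (prun N (\<lambda>_. s) n)"
    by blast
  consider "\<nexists>i. reads (prun M v t) i"
    | i where "reads (prun M v t) i" "prints i (sub i (T i))"
    | i where "reads (prun M v t) i" "\<not> prints i (sub i (T i))"
    by blast
  then show ?case
  proof cases
    case 1
    with step_master[OF r, of v] show ?thesis
      by (intro exI[of _ "Suc t"] exI[of _ T]) simp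
  next
    case (2 i)
    with step_deliver[OF r 2 refl] show ?thesis
      unfolding sub_upd by (intro exI[of _ "Suc t"] exI[of _ "T(i := Suc (T i))"]) simp
  next
    case (3 i)
    with step_sub[OF r 3] show ?thesis
      unfolding sub_upd by (intro exI[of _ t] exI[of _ "T(i := Suc (T i))"]) simp
  qed
qed

text \<open>A read of the master either blocks, and then nothing has to be simulated, or asks for a
  symbol present in coroutine \<open>i\<close> at some time \<open>\<tau>\<close>. In the latter
  case the distance \<open>\<tau> - T i\<close> decreases until the symbol is delivered.\<close>

lemma complete: "\<exists>n T. rel (prun M v t) (\<lambda>i. sub i (T i)) (prun N (\<lambda>_. s) n)"
proof (induction t)
  case 0
  show ?case using rel_init by (intro exI[of _ 0] exI[of _ "\<lambda>_. 0"]) simp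
next
  case (Suc t)
  then obtain n T where r: "rel (prun M v t) (\<lambda>i. sub i (T i)) (prun N (\<lambda>_. s) n)"
    by blast
  show ?case
  proof (cases "\<exists>i. reads (prun M v t) i")
    case False
    with step_master[OF r, of v] show ?thesis
      by (intro exI[of _ "Suc n"] exI[of _ T]) simp
  next
    case True
    then obtain i where i: "reads (prun M v t) i" by blast
    show ?thesis
    proof (cases "v i (rpos (prun M v t) i)")
      case None
      with i have "prun M v (Suc t) = prun M v t"
        by (auto simp: pstep_def)
      with Suc show ?thesis by simp
    next
      case (Some b)
      then obtain \<tau> where \<tau>: "rpos (prun M v t) i < length (outp (sub i \<tau>))"
        unfolding pout_eq_Some by blast
      from r show ?thesis
      proof (induction "\<tau> - T i" arbitrary: n T rule: less_induct)
        case less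
        note r = less.prems
        show ?case
        proof (cases "prints i (sub i (T i))")
          case True
          from step_deliver[OF r i True refl] show ?thesis
            unfolding sub_upd by (intro exI[of _ "Suc n"] exI[of _ "T(i := Suc (T i))"]) simp
        next
          case False
          \<comment> \<open>At local time \<open>T i\<close> exactly \<open>rpos\<close> many
            symbols have been written, while at time \<open>\<tau>\<close> there are more.\<close>
          have "\<not> \<tau> \<le> T i"
            using \<tau> r prefix_length_le[OF outp_prun_mono[of \<tau> "T i" "K i" "\<lambda>_. s"]]
            by (auto simp: rel_def)
          then have "\<tau> - (T(i := Suc (T i))) i < \<tau> - T i"
            by simp
          then show ?thesis
            using step_sub[OF r i False] unfolding sub_upd
            by (intro less.hyps[of "T(i := Suc (T i))" "Suc n"]) simp_all
        qed
      qed
    qed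
  qed
qed

lemma pout_plug: "pout N (\<lambda>_. s) = pout M v"
proof (rule pout_eqI)
  fix n
  from sound[of n] show "\<exists>t. outp (prun N (\<lambda>_. s) n) = outp (prun M v t)"
    unfolding rel_def by blast
next
  fix t
  from complete[of t] show "\<exists>n. outp (prun M v t) = outp (prun N (\<lambda>_. s) n)"
    unfolding rel_def by (metis (no_types))
qed

end

text \<open>A finite program mentions finitely many heads, so only finitely many coroutines ever run
  and the combined states can be listed.\<close>

lemma plug:
  "\<exists>N. \<forall>s. pout N (\<lambda>_. s) = pout M (\<lambda>i. pout (K i) (\<lambda>_. s))"
proof -
  define h where "h a = (case a of Read i s t \<Rightarrow> i | _ \<Rightarrow> 0)" for a
  define k where "k = Suc (Max (insert 0 (h ` set M)))"
  have heads: "i < k" if "q < length M" "M ! q = Read i q0 q1" for q i q0 q1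
  proof -
    have "h (M ! q) \<le> Max (insert 0 (h ` set M))"
      using that(1) by (intro Max_ge) auto
    with that(2) show ?thesis
      by (simp add: k_def h_def)
  qed
  let ?Q = "plug_states M K k" and ?i = "(0, \<lambda>_. 0) :: nat \<times> (nat \<Rightarrow> nat)"
  have init: "?i \<in> ?Q"
    by (auto simp: plug_states_def)
  \<comment> \<open>The list \<open>ys\<close> may repeat entries, hence the least index in
    \<open>e\<close>. Putting \<open>?i\<close> first gives it number 0, as the initial state
    requires.\<close>
  obtain ys where ys: "set ys = ?Q - {?i}"
    using finite_list finite_plug_states by (metis finite_Diff)
  let ?xs = "?i # ys"
  define e where "e x = (LEAST n. ?xs ! n = x)" for x
  have e: "e x < length ?xs \<and> ?xs ! e x = x" if "x \<in> ?Q" for x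
  proof -
    have "x \<in> set ?xs"
      using that ys by auto
    then obtain n where n: "n < length ?xs" "?xs ! n = x"
      by (metis in_set_conv_nth)
    from n(2) show ?thesis
      unfolding e_def by (metis (mono_tags, lifting) LeastI Least_le n(1) order_le_less_trans)
  qed
  let ?N = "map (plug_act M K e) ?xs"
  have "plugging M K k e ?N"
  proof
    show "e ?i = 0"
      unfolding e_def by (rule Least_equality) auto
    show "e x < length ?N \<and> ?N ! e x = plug_act M K e x" if "x \<in> ?Q" for x
      using e[OF that] by (metis length_map nth_map)
  qed (use heads in blast)
  then show ?thesis
    using plugging.pout_plug by blast
qed

section \<open>Computable partial functions on Baire space\<close>

lemma unary_0 [simp]: "unary p 0 = []"
  by (simp add: unary_def)

lemma unary_prefix: "m \<le> n \<Longrightarrow> prefix (unary p m) (unary p n)"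
  by (induction rule: dec_induct) (auto simp: unary_Suc intro: prefix_order.trans)

lemma input_eq:
  assumes "k < length (unary p n)"
  shows "input p k = unary p n ! k"
proof -
  have "k < length (unary p (Suc k))"
    using length_unary[of "Suc k" p] by simp
  with assms show ?thesis
    unfolding input_def using unary_prefix[of n "Suc k" p] unary_prefix[of "Suc k" n p]
    by (cases "n \<le> Suc k") (auto simp: prefix_def nth_append)
qed

lemma emb_block_True: "k < p n \<Longrightarrow> emb p (length (unary p n) + k) = Some True"
  by (simp add: emb_def input_eq[of _ p "Suc n"] unary_Suc nth_append)

lemma emb_block_False: "emb p (length (unary p n) + p n) = Some False"
  by (simp add: emb_def input_eq[of _ p "Suc n"] unary_Suc nth_append)

text \<open>The blocks are nonempty, so the prefixes \<open>unary z n\<close> exhaust the code of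
  \<open>z\<close>. This turns the production of a sequence into an equation between streams, which
  is the form that plugging preserves.\<close>

lemma pout_eq_emb:
  "pout M v = emb z \<longleftrightarrow> (\<forall>n. \<exists>t. prefix (unary z n) (outp (prun M v t)))"
proof
  assume eq: "pout M v = emb z"
  show "\<forall>n. \<exists>t. prefix (unary z n) (outp (prun M v t))"
  proof
    fix n
    let ?l = "length (unary z n)"
    obtain t where t: "?l < length (outp (prun M v t))"
      using eq pout_eq_Some[of M v ?l "input z ?l"] by (auto simp: emb_def)
    have "unary z n ! k = outp (prun M v t) ! k" if k: "k < ?l" for k
    proof -
      have "pout M v k = Some (outp (prun M v t) ! k)"
        using t k unfolding pout_eq_Some by (intro exI[of _ t]) simp
      with eq input_eq[OF k] show ?thesis
        by (simp add: emb_def)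
    qed
    then have "unary z n = take ?l (outp (prun M v t))"
      using t by (intro nth_equalityI) auto
    then show "\<exists>t. prefix (unary z n) (outp (prun M v t))"
      by (metis take_is_prefix)
  qed
next
  assume pre: "\<forall>n. \<exists>t. prefix (unary z n) (outp (prun M v t))"
  show "pout M v = emb z"
  proof
    fix k
    obtain t where t: "prefix (unary z (Suc k)) (outp (prun M v t))"
      using pre by blast
    have "k < length (unary z (Suc k))"
      using length_unary[of "Suc k" z] by simp
    then have "pout M v k = Some (unary z (Suc k) ! k)"
      using t by (auto simp: pout_eq_Some prefix_def nth_append intro!: exI[of _ t])
    then show "pout M v k = emb z k"
      by (simp add: emb_def input_def)
  qed
qed

lemma sem_eq_Some_pout: "sem M p = Some r \<longleftrightarrow> pout M (\<lambda>_. emb p) = emb r"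
proof -
  have "prun M (\<lambda>_. emb p) t = run M (input p) t" for t
    using prun_emb[of M "input p" t] by (simp add: emb_def[abs_def])
  then show ?thesis
    by (simp add: sem_eq_Some produces_def pout_eq_emb)
qed

text \<open>Cut the stream after each \<open>False\<close>; the lengths of the runs of
  \<open>True\<close> between the cuts are the numbers of \<open>r\<close>.\<close>

lemma ex_emb:
  assumes inf: "\<And>m. \<exists>k\<ge>m. b k = Some False" and total: "\<And>k. b k \<noteq> None"
  shows "\<exists>r. b = emb r"
proof -
  define gap where "gap m = (LEAST j. b (m + j) = Some False)" for m
  have gap_False: "b (m + gap m) = Some False" for m
  proof -
    obtain k where "k \<ge> m" "b k = Some False"
      using inf by blast
    then have "b (m + (k - m)) = Some False"
      by simp
    then show ?thesis
      unfolding gap_def by (rule LeastI)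
  qed
  have gap_True: "b (m + j) = Some True" if "j < gap m" for m j
    using not_less_Least[OF that[unfolded gap_def]] total[of "m + j"] by auto
  \<comment> \<open>Block \<open>n\<close> begins at \<open>pos n\<close>; it consists of
    \<open>gap (pos n)\<close> symbols \<open>True\<close> and one delimiter.\<close>
  define pos where "pos = rec_nat 0 (\<lambda>_ m. m + Suc (gap m))"
  define r where "r n = gap (pos n)" for n
  have pos: "pos 0 = 0" "pos (Suc n) = pos n + Suc (r n)" for n
    by (simp_all add: pos_def r_def)
  have r_True: "b (pos n + j) = Some True" if "j < r n" for j n
    using gap_True that by (simp add: r_def)
  have r_False: "b (pos n + r n) = Some False" for n
    using gap_False by (simp add: r_def)
  have unary: "length (unary r n) = pos n \<and> (\<forall>k < pos n. b k = Some (unary r n ! k))" for n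
  proof (induction n)
    case (Suc n)
    have "b k = Some (unary r (Suc n) ! k)" if k: "k < pos (Suc n)" for k
    proof (cases "k < pos n")
      case True
      with Suc show ?thesis by (simp add: unary_Suc nth_append)
    next
      case False
      then obtain j where j: "k = pos n + j"
        by (metis le_add_diff_inverse not_less)
      with k have "j \<le> r n"
        by (simp add: pos)
      with j Suc r_True[of j n] r_False[of n] show ?thesis
        by (cases "j = r n") (auto simp: unary_Suc nth_append)
    qed
    with Suc show ?case
      by (simp add: unary_Suc pos)
  qed (simp add: pos)
  have "b k = emb r k" for k
  proof -
    have "k < pos (Suc k)"
      using unary[of "Suc k"] length_unary[of "Suc k" r] by simp
    with unary[of "Suc k"] show ?thesis
      by (simp add: emb_def input_def)
  qed
  then show ?thesis by blast
qed

lemma emb_False: "\<exists>k\<ge>m. emb r k = Some False"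
proof -
  have "m \<le> length (unary r m) + r m"
    using length_unary[of m r] by simp
  with emb_block_False[of r m] show ?thesis by blast
qed

section \<open>Runs of concrete machines over unary blocks\<close>

definition reach :: "machine \<Rightarrow> streams \<Rightarrow> config \<Rightarrow> config \<Rightarrow> bool" where
  "reach M v c c' \<longleftrightarrow> (\<exists>t. c' = (pstep M v ^^ t) c)"

lemma reach_refl [simp]: "reach M v c c"
  unfolding reach_def by (metis funpow_0)

lemma reach_trans: "reach M v c c' \<Longrightarrow> reach M v c' c'' \<Longrightarrow> reach M v c c''"
  unfolding reach_def by (metis comp_apply funpow_add)

lemma reach_pstep: "reach M v c (pstep M v c)"
  unfolding reach_def by (metis funpow_0 funpow_simps_right(2) comp_apply)

lemma reach_Read:
  assumes "ctrl c < length M" "M ! ctrl c = Read i s t" "v i (rpos c i) = Some b"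
  shows "reach M v c (c\<lparr>ctrl := (if b then t else s), rpos := (rpos c)(i := Suc (rpos c i))\<rparr>)"
  using reach_pstep[of M v c] assms by (simp add: pstep_def)

lemma reach_Print:
  assumes "ctrl c < length M" "M ! ctrl c = Print b s"
  shows "reach M v c (c\<lparr>ctrl := s, outp := outp c @ [b]\<rparr>)"
  using reach_pstep[of M v c] assms by (simp add: pstep_def)

text \<open>State \<open>s\<close> loops on \<open>True\<close> and leaves on \<open>False\<close>;
  \<open>Suc m\<close> counts the delimiter as well.\<close>

lemma reach_skip:
  assumes M: "s < length M" "M ! s = Read i s' s"
    and "ctrl c = s" "\<And>k. k < m \<Longrightarrow> v i (rpos c i + k) = Some True"
    and "v i (rpos c i + m) = Some False"
  shows "reach M v c (c\<lparr>ctrl := s', rpos := (rpos c)(i := rpos c i + Suc m)\<rparr>)"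
  using assms(3-)
proof (induction m arbitrary: c)
  case 0
  then show ?case
    using reach_Read[of c M i s' s v False] M by (simp add: fun_upd_def)
next
  case (Suc m)
  let ?c = "c\<lparr>ctrl := s, rpos := (rpos c)(i := Suc (rpos c i))\<rparr>"
  have "reach M v c ?c"
    using reach_Read[of c M i s' s v True] M Suc.prems(1) Suc.prems(2)[of 0] by simp
  moreover have "v i (rpos ?c i + k) = Some True" if "k < m" for k
    using Suc.prems(2)[of "Suc k"] that by simp
  then have "reach M v ?c (?c\<lparr>ctrl := s', rpos := (rpos ?c)(i := rpos ?c i + Suc m)\<rparr>)"
    by (intro Suc.IH) (use Suc.prems(3) in simp_all)
  ultimately have "reach M v c (?c\<lparr>ctrl := s', rpos := (rpos ?c)(i := rpos ?c i + Suc m)\<rparr>)"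
    using reach_trans by blast
  moreover have "?c\<lparr>ctrl := s', rpos := (rpos ?c)(i := rpos ?c i + Suc m)\<rparr>
      = c\<lparr>ctrl := s', rpos := (rpos c)(i := rpos c i + Suc (Suc m))\<rparr>"
    by (rule config.equality) (auto simp: fun_eq_iff)
  ultimately show ?case by (simp only:)
qed

text \<open>The three states form a copying loop: \<open>s2\<close> echoes a \<open>True\<close> and
  returns to \<open>s\<close>, while \<open>s1\<close> echoes the delimiter and leaves for
  \<open>s'\<close>.\<close>

lemma reach_copy:
  assumes M: "s < length M" "M ! s = Read i s1 s2"
    "s1 < length M" "M ! s1 = Print False s'" "s2 < length M" "M ! s2 = Print True s"
    and "ctrl c = s" "\<And>k. k < m \<Longrightarrow> v i (rpos c i + k) = Some True"
    and "v i (rpos c i + m) = Some False"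
  shows "reach M v c (c\<lparr>ctrl := s', rpos := (rpos c)(i := rpos c i + Suc m),
           outp := outp c @ replicate m True @ [False]\<rparr>)"
  using assms(7-)
proof (induction m arbitrary: c)
  case 0
  let ?c = "c\<lparr>ctrl := s1, rpos := (rpos c)(i := Suc (rpos c i))\<rparr>"
  have "reach M v c ?c"
    using reach_Read[of c M i s1 s2 v False] M 0 by simp
  moreover have "reach M v ?c (?c\<lparr>ctrl := s', outp := outp ?c @ [False]\<rparr>)"
    by (intro reach_Print) (use M in simp_all)
  ultimately have "reach M v c (?c\<lparr>ctrl := s', outp := outp ?c @ [False]\<rparr>)"
    using reach_trans by blast
  moreover have "?c\<lparr>ctrl := s', outp := outp ?c @ [False]\<rparr>
      = c\<lparr>ctrl := s', rpos := (rpos c)(i := rpos c i + Suc 0),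
          outp := outp c @ replicate 0 True @ [False]\<rparr>"
    by (rule config.equality) (auto simp: fun_eq_iff)
  ultimately show ?case by (simp only:)
next
  case (Suc m)
  let ?c = "c\<lparr>ctrl := s2, rpos := (rpos c)(i := Suc (rpos c i))\<rparr>"
  let ?d = "?c\<lparr>ctrl := s, outp := outp ?c @ [True]\<rparr>"
  have "reach M v c ?c"
    using reach_Read[of c M i s1 s2 v True] M Suc.prems(1) Suc.prems(2)[of 0] by simp
  moreover have "reach M v ?c ?d"
    by (intro reach_Print) (use M in simp_all)
  moreover have "v i (rpos ?d i + k) = Some True" if "k < m" for k
    using Suc.prems(2)[of "Suc k"] that by simp
  then have "reach M v ?d (?d\<lparr>ctrl := s', rpos := (rpos ?d)(i := rpos ?d i + Suc m),
      outp := outp ?d @ replicate m True @ [False]\<rparr>)"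
    by (intro Suc.IH) (use Suc.prems(3) in simp_all)
  ultimately have "reach M v c (?d\<lparr>ctrl := s', rpos := (rpos ?d)(i := rpos ?d i + Suc m),
      outp := outp ?d @ replicate m True @ [False]\<rparr>)"
    using reach_trans by blast
  moreover have "?d\<lparr>ctrl := s', rpos := (rpos ?d)(i := rpos ?d i + Suc m),
      outp := outp ?d @ replicate m True @ [False]\<rparr>
      = c\<lparr>ctrl := s', rpos := (rpos c)(i := rpos c i + Suc (Suc m)),
          outp := outp c @ replicate (Suc m) True @ [False]\<rparr>"
    by (rule config.equality) (auto simp: fun_eq_iff)
  ultimately show ?case by (simp only:)
qed

lemma reach_skip_block:
  assumes "ctrl c < length M" "M ! ctrl c = Read i s' (ctrl c)"
    and "v i = emb p" "rpos c i = length (unary p n)"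
  shows "reach M v c (c\<lparr>ctrl := s', rpos := (rpos c)(i := length (unary p (Suc n)))\<rparr>)"
  using reach_skip[of "ctrl c" M i s' c "p n" v] assms
  by (simp add: emb_block_True emb_block_False unary_Suc)

lemma reach_copy_block:
  assumes "ctrl c < length M" "M ! ctrl c = Read i s1 s2"
    "s1 < length M" "M ! s1 = Print False s'" "s2 < length M" "M ! s2 = Print True (ctrl c)"
    and "v i = emb p" "rpos c i = length (unary p n)"
  shows "reach M v c (c\<lparr>ctrl := s', rpos := (rpos c)(i := length (unary p (Suc n))),
           outp := outp c @ replicate (p n) True @ [False]\<rparr>)"
  using reach_copy[of "ctrl c" M i s1 s2 s' c "p n" v] assms
  by (simp add: emb_block_True emb_block_False unary_Suc)

lemma pout_eq_embI:
  assumes "\<And>n. \<exists>c. reach M v init_config c \<and> prefix (unary z n) (outp c)"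
  shows "pout M v = emb z"
  using assms unfolding pout_eq_emb reach_def prun_def by blast

text \<open>States 0 to 2 copy a block with even index, and state 3 skips the following one.\<close>

definition proj1_machine :: machine where
  "proj1_machine = [Read 0 1 2, Print False 3, Print True 0, Read 0 0 3]"

text \<open>State 0 skips a block with even index, and states 1 to 3 copy the following one.\<close>

definition proj2_machine :: machine where
  "proj2_machine = [Read 0 1 0, Read 0 2 3, Print False 0, Print True 1]"

text \<open>States 0 to 2 copy a block from head 0, and states 3 to 5 one from head 1.\<close>

definition pair_machine :: machine where
  "pair_machine =
     [Read 0 1 2, Print False 3, Print True 0, Read 1 4 5, Print False 0, Print True 3]"

lemma pout_proj1: "pout proj1_machine (\<lambda>_. emb r) = emb (proj1 r)"
proof (rule pout_eq_embI)
  fix n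
  let ?M = proj1_machine and ?v = "\<lambda>_ :: nat. emb r"
  have proj: "proj1 r n = r (2 * n)" for n
    by (simp add: proj1_def)
  have "\<exists>c. reach ?M ?v init_config c \<and> ctrl c = 0 \<and>
      rpos c 0 = length (unary r (2 * n)) \<and> outp c = unary (proj1 r) n"
  proof (induction n)
    case 0
    show ?case by (intro exI[of _ init_config]) simp
  next
    case (Suc n)
    then obtain c where c: "reach ?M ?v init_config c" "ctrl c = 0"
      "rpos c 0 = length (unary r (2 * n))" "outp c = unary (proj1 r) n"
      by blast
    let ?d = "c\<lparr>ctrl := 3, rpos := (rpos c)(0 := length (unary r (Suc (2 * n)))),
      outp := outp c @ replicate (r (2 * n)) True @ [False]\<rparr>"
    let ?e = "?d\<lparr>ctrl := 0, rpos := (rpos ?d)(0 := length (unary r (Suc (Suc (2 * n)))))\<rparr>"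
    have "reach ?M ?v c ?d"
      by (rule reach_copy_block[of _ _ _ 1 2]) (use c in \<open>simp_all add: proj1_machine_def\<close>)
    moreover have "reach ?M ?v ?d ?e"
      by (rule reach_skip_block) (simp_all add: proj1_machine_def)
    ultimately have "reach ?M ?v init_config ?e"
      using c(1) reach_trans by blast
    then show ?case
      by (intro exI[of _ ?e]) (simp add: c unary_Suc proj[of n])
  qed
  then show "\<exists>c. reach ?M ?v init_config c \<and> prefix (unary (proj1 r) n) (outp c)"
    by auto
qed

lemma pout_proj2: "pout proj2_machine (\<lambda>_. emb r) = emb (proj2 r)"
proof (rule pout_eq_embI)
  fix n
  let ?M = proj2_machine and ?v = "\<lambda>_ :: nat. emb r"
  have proj: "proj2 r n = r (Suc (2 * n))" for n
    by (simp add: proj2_def)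
  have "\<exists>c. reach ?M ?v init_config c \<and> ctrl c = 0 \<and>
      rpos c 0 = length (unary r (2 * n)) \<and> outp c = unary (proj2 r) n"
  proof (induction n)
    case 0
    show ?case by (intro exI[of _ init_config]) simp
  next
    case (Suc n)
    then obtain c where c: "reach ?M ?v init_config c" "ctrl c = 0"
      "rpos c 0 = length (unary r (2 * n))" "outp c = unary (proj2 r) n"
      by blast
    let ?d = "c\<lparr>ctrl := 1, rpos := (rpos c)(0 := length (unary r (Suc (2 * n))))\<rparr>"
    let ?e = "?d\<lparr>ctrl := 0, rpos := (rpos ?d)(0 := length (unary r (Suc (Suc (2 * n))))),
      outp := outp ?d @ replicate (r (Suc (2 * n))) True @ [False]\<rparr>"
    have "reach ?M ?v c ?d"
      by (rule reach_skip_block) (use c in \<open>simp_all add: proj2_machine_def\<close>)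
    moreover have "reach ?M ?v ?d ?e"
      by (rule reach_copy_block[of _ _ _ 2 3]) (simp_all add: proj2_machine_def)
    ultimately have "reach ?M ?v init_config ?e"
      using c(1) reach_trans by blast
    then show ?case
      by (intro exI[of _ ?e]) (simp add: c unary_Suc proj[of n])
  qed
  then show "\<exists>c. reach ?M ?v init_config c \<and> prefix (unary (proj2 r) n) (outp c)"
    by auto
qed

lemma pout_pair:
  assumes v: "v 0 = emb p" "v 1 = emb q"
  shows "pout pair_machine v = emb (pair p q)"
proof (rule pout_eq_embI)
  fix n
  let ?M = pair_machine
  have pair: "pair p q (2 * n) = p n" "pair p q (Suc (2 * n)) = q n" for n
    by (simp_all add: pair_def)
  have "\<exists>c. reach ?M v init_config c \<and> ctrl c = 0 \<and> rpos c 0 = length (unary p n) \<and>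
      rpos c 1 = length (unary q n) \<and> outp c = unary (pair p q) (2 * n)"
  proof (induction n)
    case 0
    show ?case by (intro exI[of _ init_config]) simp
  next
    case (Suc n)
    then obtain c where c: "reach ?M v init_config c" "ctrl c = 0" "rpos c 0 = length (unary p n)"
      "rpos c 1 = length (unary q n)" "outp c = unary (pair p q) (2 * n)"
      by blast
    let ?d = "c\<lparr>ctrl := 3, rpos := (rpos c)(0 := length (unary p (Suc n))),
      outp := outp c @ replicate (p n) True @ [False]\<rparr>"
    let ?e = "?d\<lparr>ctrl := 0, rpos := (rpos ?d)(1 := length (unary q (Suc n))),
      outp := outp ?d @ replicate (q n) True @ [False]\<rparr>"
    have "reach ?M v c ?d"
      by (rule reach_copy_block[of _ _ _ 1 2]) (use c v in \<open>simp_all add: pair_machine_def\<close>)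
    moreover have "reach ?M v ?d ?e"
      by (rule reach_copy_block[of _ _ _ 4 5]) (use c v in \<open>simp_all add: pair_machine_def\<close>)
    ultimately have "reach ?M v init_config ?e"
      using c(1) reach_trans by blast
    then show ?case
      by (intro exI[of _ ?e]) (simp add: c unary_Suc pair[of n])
  qed
  then obtain c where "reach ?M v init_config c" "outp c = unary (pair p q) (2 * n)"
    by blast
  then show "\<exists>c. reach ?M v init_config c \<and> prefix (unary (pair p q) n) (outp c)"
    using unary_prefix[of n "2 * n" "pair p q"] by auto
qed

text \<open>State 0 searches for a \<open>False\<close> under head 1, state 1 then fetches one
  symbol from head 0, and states 2 and 3 print it.\<close>

definition gate_machine :: machine where
  "gate_machine = [Read 1 1 0, Read 0 2 3, Print False 0, Print True 0]"

text \<open>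
  The gate copies head 0, but only one symbol per False found by head 1.  The counting invariant
  thus turns infinite output into infinitely many False under head 1.
\<close>

definition gate_inv :: "streams \<Rightarrow> config \<Rightarrow> bool" where
  "gate_inv v c \<longleftrightarrow> ctrl c < 4 \<and>
     (\<forall>k<rpos c 1. v 1 k \<noteq> None) \<and>
     length (outp c) + (if ctrl c = 0 then 0 else 1)
       \<le> card {k. k < rpos c 1 \<and> v 1 k = Some False} \<and>
     rpos c 0 = length (outp c) + (if ctrl c < 2 then 0 else 1) \<and>
     (\<forall>k<length (outp c). v 0 k = Some (outp c ! k)) \<and>
     (ctrl c \<ge> 2 \<longrightarrow> v 0 (length (outp c)) = Some (ctrl c = 3))"

lemma gate_inv_step: "gate_inv v c \<Longrightarrow> gate_inv v (pstep gate_machine v c)"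
proof -
  assume inv: "gate_inv v c"
  then consider "ctrl c = 0" | "ctrl c = 1" | "ctrl c = 2" | "ctrl c = 3"
    unfolding gate_inv_def by linarith
  then show ?thesis
  proof cases
    case 1
    show ?thesis
    proof (cases "v 1 (rpos c 1)")
      case None
      with inv 1 show ?thesis
        by (simp add: pstep_def gate_machine_def)
    next
      case (Some b)
      let ?F = "{k. k < rpos c 1 \<and> v 1 k = Some False}"
      \<comment> \<open>State 0 is left only on \<open>False\<close>; the new delimiter in the count
        pays for the extra 1 that the invariant charges outside state 0.\<close>
      have "{k. k < Suc (rpos c 1) \<and> v 1 k = Some False} = (if b then ?F else insert (rpos c 1) ?F)"
        using Some by (auto simp: less_Suc_eq)
      moreover have "card (insert (rpos c 1) ?F) = Suc (card ?F)"
        by (subst card_insert_disjoint) auto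
      ultimately show ?thesis
        using inv 1 Some by (auto simp: pstep_def gate_machine_def gate_inv_def less_Suc_eq)
    qed
  qed (use inv in \<open>auto simp: pstep_def gate_machine_def gate_inv_def nth_append less_Suc_eq
        split: option.splits\<close>)
qed

lemma gate_inv_prun: "gate_inv v (prun gate_machine v t)"
  by (induction t) (simp_all add: gate_inv_step, simp add: gate_inv_def)

text \<open>Head 0 supplies the value, and head 1 merely certifies that its stream is a complete
  code. Infinite output forces infinitely many delimiters, and \<open>ex_emb\<close> applies;
  conversely each round ends because a next delimiter exists.\<close>

lemma pout_gate:
  "pout gate_machine v = emb z \<longleftrightarrow> v 0 = emb z \<and> (\<exists>r. v 1 = emb r)"
proof -
  let ?G = gate_machine
  have sound: "v 0 k = Some b" if "pout ?G v k = Some b" for k b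
    using that gate_inv_prun[of v] unfolding pout_eq_Some gate_inv_def by blast
  show ?thesis
  proof
    assume z: "pout ?G v = emb z"
    then have "v 0 k = emb z k" for k
      using sound by (simp add: emb_def)
    moreover have "\<exists>r. v 1 = emb r"
    proof -
      have *: "(\<exists>k\<ge>m. v 1 k = Some False) \<and> v 1 m \<noteq> None" for m
      proof -
        obtain t where t: "Suc m < length (outp (prun ?G v t))"
          using z pout_eq_Some[of ?G v "Suc m"] by (auto simp: emb_def)
        let ?F = "{k. k < rpos (prun ?G v t) 1 \<and> v 1 k = Some False}"
        have "Suc m < card ?F"
          using t gate_inv_prun[of v t] by (auto simp: gate_inv_def split: if_splits)
        \<comment> \<open>Pigeonhole: more than \<open>Suc m\<close> delimiters have been read, so
          one of them lies at a position of at least \<open>Suc m\<close>, and position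
          \<open>m\<close> has been read too.\<close>
        moreover have "card ?F \<le> Suc m" if "?F \<subseteq> {..<Suc m}"
          using card_mono[OF _ that] by simp
        ultimately have "\<not> ?F \<subseteq> {..<Suc m}"
          by linarith
        then obtain k where k: "k \<in> ?F" "k \<notin> {..<Suc m}"
          by blast
        then have "m < rpos (prun ?G v t) 1"
          by auto
        with k gate_inv_prun[of v t] show ?thesis
          unfolding gate_inv_def by (auto simp: not_less intro!: exI[of _ k])
      qed
      show ?thesis
        by (rule ex_emb) (use * in blast)+
    qed
    ultimately show "v 0 = emb z \<and> (\<exists>r. v 1 = emb r)"
      by blast
  next
    assume "v 0 = emb z \<and> (\<exists>r. v 1 = emb r)"
    then obtain r where v: "v 0 = emb z" "v 1 = emb r"
      by blast
    \<comment> \<open>One round of the gate per symbol: skip to the next delimiter at distance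
      \<open>m\<close> under head 1, read from head 0, print.\<close>
    have progress: "\<exists>t. ctrl (prun ?G v t) = 0 \<and> length (outp (prun ?G v t)) = n" for n
    proof (induction n)
      case 0
      show ?case by (intro exI[of _ 0]) simp
    next
      case (Suc n)
      then obtain t where t: "ctrl (prun ?G v t) = 0" "length (outp (prun ?G v t)) = n"
        by blast
      let ?c = "prun ?G v t"
      define m where "m = (LEAST j. v 1 (rpos ?c 1 + j) = Some False)"
      obtain k where "k \<ge> rpos ?c 1" "v 1 k = Some False"
        using emb_False v(2) by metis
      then have "v 1 (rpos ?c 1 + (k - rpos ?c 1)) = Some False"
        by simp
      then have m: "v 1 (rpos ?c 1 + m) = Some False"
        unfolding m_def by (rule LeastI)
      have m': "v 1 (rpos ?c 1 + j) = Some True" if "j < m" for j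
        using not_less_Least[OF that[unfolded m_def]] v(2) by (simp add: emb_def)
      let ?d = "?c\<lparr>ctrl := 1, rpos := (rpos ?c)(1 := rpos ?c 1 + Suc m)\<rparr>"
      have "reach ?G v ?c ?d"
        by (rule reach_skip) (use t m m' in \<open>simp_all add: gate_machine_def\<close>)
      moreover
      let ?b = "input z (rpos ?d 0)"
      let ?e = "?d\<lparr>ctrl := (if ?b then 3 else 2), rpos := (rpos ?d)(0 := Suc (rpos ?d 0))\<rparr>"
      have "reach ?G v ?d ?e"
        by (rule reach_Read) (use v in \<open>simp_all add: gate_machine_def emb_def\<close>)
      moreover
      let ?f = "?e\<lparr>ctrl := 0, outp := outp ?e @ [?b]\<rparr>"
      have "reach ?G v ?e ?f"
        by (rule reach_Print) (simp_all add: gate_machine_def)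
      ultimately have "reach ?G v ?c ?f"
        using reach_trans by blast
      then obtain t' where t': "?f = (pstep ?G v ^^ t') ?c"
        unfolding reach_def by blast
      have "prun ?G v (t' + t) = ?f"
        unfolding t' by (simp add: prun_def funpow_add)
      with t show ?case
        by (intro exI[of _ "t' + t"]) simp
    qed
    show "pout ?G v = emb z"
    proof
      fix k
      obtain t where "length (outp (prun ?G v t)) = Suc k"
        using progress by blast
      then have "pout ?G v k = Some (outp (prun ?G v t) ! k)"
        unfolding pout_eq_Some by (intro exI[of _ t]) simp
      with sound v(1) show "pout ?G v k = emb z k"
        by metis
    qed
  qed
qed

text \<open>
  The outer machine of a composition may read only part of what the inner one writes, but
  the result has to diverge with the inner machine.
\<close>

lemma guard:
  "\<exists>N. \<forall>p z. sem N p = Some z \<longleftrightarrow> pout A (\<lambda>_. emb p) = emb z \<and> (\<exists>r. sem B p = Some r)"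
proof -
  obtain N where "\<And>s. pout N (\<lambda>_. s)
      = pout gate_machine (\<lambda>i. pout (if i = 0 then A else B) (\<lambda>_. s))"
    using plug[of gate_machine "\<lambda>i. if i = 0 then A else B"] by blast
  then show ?thesis
    by (intro exI[of _ N]) (simp add: sem_eq_Some_pout pout_gate)
qed

section \<open>Closure properties of computable partial functions with exact domains\<close>

lemma partial_eqI: "(\<And>p z. F p = Some z \<longleftrightarrow> G p = Some z) \<Longrightarrow> F = G"
  by (intro ext) (metis option.exhaust)

lemma computable_comp:
  assumes "computable_baire F" "computable_baire G"
  shows "computable_baire (F \<circ>\<^sub>m G)"
proof -
  obtain M K where F: "F = sem M" and G: "G = sem K"
    using assms by (auto simp: computable_baire_def)
  obtain A where A: "\<And>s. pout A (\<lambda>_. s) = pout M (\<lambda>_. pout K (\<lambda>_. s))"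
    using plug[of M "\<lambda>_. K"] by blast
  obtain N where N: "\<And>p z. sem N p = Some z \<longleftrightarrow>
      pout A (\<lambda>_. emb p) = emb z \<and> (\<exists>r. sem K p = Some r)"
    using guard[of A K] by blast
  have "(F \<circ>\<^sub>m G) p = Some z \<longleftrightarrow> sem N p = Some z" for p z
    unfolding N A F G by (auto simp: map_comp_Some_iff sem_eq_Some_pout)
  then have "F \<circ>\<^sub>m G = sem N"
    by (rule partial_eqI)
  then show ?thesis
    by (auto simp: computable_baire_def)
qed

text \<open>Guarding by the two components in turn makes the domain exactly their common
  domain.\<close>

lemma computable_pair:
  assumes "computable_baire F" "computable_baire G"
  shows "computable_baire (\<lambda>p. case (F p, G p) of (Some a, Some b) \<Rightarrow> Some (pair a b) | _ \<Rightarrow> None)"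
    (is "computable_baire ?H")
proof -
  obtain M K where F: "F = sem M" and G: "G = sem K"
    using assms by (auto simp: computable_baire_def)
  obtain A where A: "\<And>s. pout A (\<lambda>_. s) =
      pout pair_machine (\<lambda>i. pout (if i = 0 then M else K) (\<lambda>_. s))"
    using plug[of pair_machine "\<lambda>i. if i = 0 then M else K"] by blast
  obtain B where B: "\<And>p z. sem B p = Some z \<longleftrightarrow>
      pout A (\<lambda>_. emb p) = emb z \<and> (\<exists>r. sem M p = Some r)"
    using guard[of A M] by blast
  obtain N where N: "\<And>p z. sem N p = Some z \<longleftrightarrow>
      pout B (\<lambda>_. emb p) = emb z \<and> (\<exists>r. sem K p = Some r)"
    using guard[of B K] by blast
  have "?H p = Some z \<longleftrightarrow> sem N p = Some z" for p z
  proof (cases "F p")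
    case None
    then show ?thesis
      unfolding N by (simp add: B F flip: sem_eq_Some_pout)
  next
    case (Some a)
    show ?thesis
    proof (cases "G p")
      case None
      with N G show ?thesis by (auto split: option.splits)
    next
      case (Some b)
      with \<open>F p = Some a\<close> have "pout A (\<lambda>_. emb p) = emb (pair a b)"
        unfolding A by (intro pout_pair) (simp_all add: F G sem_eq_Some_pout)
      with \<open>F p = Some a\<close> Some have "sem N p = Some (pair a b)"
        unfolding N by (simp add: B F G flip: sem_eq_Some_pout)
      with \<open>F p = Some a\<close> Some show ?thesis by simp
    qed
  qed
  then have "?H = sem N"
    by (rule partial_eqI)
  then show ?thesis
    by (auto simp: computable_baire_def)
qed

lemma computable_proj1: "computable_baire (\<lambda>p. Some (proj1 p))"
proof -
  have "(\<lambda>p. Some (proj1 p)) = sem proj1_machine"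
    by (intro ext) (simp add: sem_eq_Some_pout pout_proj1 eq_commute[of "Some _"])
  then show ?thesis
    by (auto simp: computable_baire_def)
qed

lemma computable_proj2: "computable_baire (\<lambda>p. Some (proj2 p))"
proof -
  have "(\<lambda>p. Some (proj2 p)) = sem proj2_machine"
    by (intro ext) (simp add: sem_eq_Some_pout pout_proj2 eq_commute[of "Some _"])
  then show ?thesis
    by (auto simp: computable_baire_def)
qed

lemma computable_bind:
  assumes "computable_baire F" "computable_baire G"
  shows "computable_baire (\<lambda>u. Option.bind (G u) F)"
proof -
  have "(\<lambda>u. Option.bind (G u) F) = F \<circ>\<^sub>m G"
    by (auto simp: map_comp_def fun_eq_iff split: option.split)
  with computable_comp[OF assms] show ?thesis by simp
qed

lemma computable_proj:
  assumes "computable_baire (\<lambda>u. Some (h u))"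
  shows "computable_baire (\<lambda>u. Some (proj1 (h u)))" "computable_baire (\<lambda>u. Some (proj2 (h u)))"
  using computable_bind[OF computable_proj1 assms] computable_bind[OF computable_proj2 assms]
  by simp_all

text \<open>Serves to build nested partial evaluations from the inside outwards; \<open>h\<close>
  hands on data of the original input next to the intermediate result.\<close>

lemma computable_bind_pair_left:
  assumes "computable_baire F" "computable_baire G" "computable_baire (\<lambda>u. Some (h u))"
  shows "computable_baire (\<lambda>u. Option.bind (G u) (\<lambda>a. F (pair a (h u))))"
proof -
  let ?P = "\<lambda>u. case (G u, Some (h u)) of (Some a, Some b) \<Rightarrow> Some (pair a b) | _ \<Rightarrow> None"
  have "(\<lambda>u. Option.bind (G u) (\<lambda>a. F (pair a (h u)))) = (\<lambda>u. Option.bind (?P u) F)"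
    by (auto simp: fun_eq_iff split: option.split)
  with computable_bind[OF assms(1) computable_pair[OF assms(2,3)]] show ?thesis by simp
qed

lemma computable_bind_pair_right:
  assumes "computable_baire F" "computable_baire (\<lambda>u. Some (h u))" "computable_baire G"
  shows "computable_baire (\<lambda>u. Option.bind (G u) (\<lambda>a. F (pair (h u) a)))"
proof -
  let ?P = "\<lambda>u. case (Some (h u), G u) of (Some a, Some b) \<Rightarrow> Some (pair a b) | _ \<Rightarrow> None"
  have "(\<lambda>u. Option.bind (G u) (\<lambda>a. F (pair (h u) a))) = (\<lambda>u. Option.bind (?P u) F)"
    by (auto simp: fun_eq_iff split: option.split)
  with computable_bind[OF assms(1) computable_pair[OF assms(2,3)]] show ?thesis by simp
qed

lemma computable_id: "computable_baire (\<lambda>u. Some u)"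
  using computable_pair[OF computable_proj1 computable_proj2] by simp

lemma computable_total_pair:
  assumes "computable_baire (\<lambda>u. Some (h u))" "computable_baire (\<lambda>u. Some (k u))"
  shows "computable_baire (\<lambda>u. Some (pair (h u) (k u)))"
  using computable_pair[OF assms] by simp

lemma computable_app:
  assumes "computable_baire F" "computable_baire (\<lambda>u. Some (h u))"
  shows "computable_baire (\<lambda>u. F (h u))"
  using computable_bind[OF assms] by simp

lemma computable_sem: "computable_baire (sem M)"
  by (auto simp: computable_baire_def)

section \<open>Continuity\<close>

text \<open>Since no block is empty, cell \<open>k\<close> of the code is determined by the numbers
  up to index \<open>k\<close>.\<close>

lemma input_local:
  assumes "\<And>i. i < t \<Longrightarrow> p i = p' i" "k < t"
  shows "input p k = input p' k"
proof -
  have "unary p (Suc k) = unary p' (Suc k)"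
    unfolding unary_def using assms by (intro arg_cong[where f = concat] map_cong) auto
  then show ?thesis by (simp add: input_def)
qed

text \<open>A head advances at most one cell per step. The bound on the heads is part of the
  induction, as it shows that the next step reads only cells on which both inputs agree.\<close>

lemma run_local:
  assumes "\<And>k. k < t \<Longrightarrow> w k = w' k"
  shows "run M w t = run M w' t \<and> (\<forall>i. rpos (run M w t) i \<le> t)"
  using assms
proof (induction t)
  case 0
  show ?case by (simp add: run_def)
next
  case (Suc t)
  let ?c = "run M w t"
  have IH: "run M w' t = ?c" "\<And>i. rpos ?c i \<le> t"
    using Suc by auto
  have run: "run M u (Suc t) = step M u (run M u t)" for u
    by (simp add: run_def)
  have "step M w ?c = step M w' ?c"
  proof (cases "M ! ctrl ?c")
    case (Read i s s')
    with Suc.prems[of "rpos ?c i"] IH(2)[of i] show ?thesis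
      by (simp add: step_def less_Suc_eq_le)
  qed (simp_all add: step_def)
  moreover have "rpos (step M w ?c) i \<le> Suc t" for i
  proof (cases "M ! ctrl ?c")
    case (Work j f)
    then show ?thesis
      using IH(2)[of i] by (auto simp: step_def le_Suc_eq split: prod.split)
  qed (use IH(2) in \<open>auto simp: step_def intro: le_SucI\<close>)
  ultimately show ?case
    by (simp add: run IH(1))
qed

text \<open>The time after which number \<open>n\<close> has been written bounds the part of the
  input consulted so far, so it can serve as \<open>N\<close>.\<close>

lemma sem_local:
  assumes "sem M p = Some r"
  obtains N where
    "\<And>p' r'. (\<And>k. k < N \<Longrightarrow> p' k = p k) \<Longrightarrow> sem M p' = Some r' \<Longrightarrow> r' n = r n"
proof -
  obtain N where N: "prefix (unary r (Suc n)) (outp (run M (input p) N))"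
    using assms unfolding sem_eq_Some produces_def by blast
  have "r' n = r n" if eq: "\<And>k. k < N \<Longrightarrow> p' k = p k" and r': "sem M p' = Some r'" for p' r'
  proof -
    obtain t where t: "prefix (unary r' (Suc n)) (outp (run M (input p') t))"
      using r' unfolding sem_eq_Some produces_def by blast
    have "run M (input p) N = run M (input p') N"
      using run_local[of N "input p" "input p'" M] input_local[of N p p'] eq by auto
    with N have N': "prefix (unary r (Suc n)) (outp (run M (input p') N))"
      by simp
    let ?o = "outp (run M (input p') (max N t))"
    have "prefix (unary r (Suc n)) ?o" "prefix (unary r' (Suc n)) ?o"
      using prefix_order.trans[OF N' outp_run_mono[of N "max N t"]]
        prefix_order.trans[OF t outp_run_mono[of t "max N t"]] by simp_all
    then obtain xs ys where "unary r (Suc n) @ xs = unary r' (Suc n) @ ys"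
      by (metis prefixE)
    from unary_inj[OF this] show ?thesis by simp
  qed
  then show thesis using that by blast
qed

lemma open_cylinder: "open {p' :: baire. \<forall>k<N. p' k = p k}"
proof -
  have "{p' :: baire. \<forall>k<N. p' k = p k} = (\<Inter>k\<in>{..<N}. (\<lambda>p'. p' k) -` {p k})"
    by auto
  moreover have "open ((\<lambda>p' :: baire. p' k) -` {p k})" for k
    by (intro open_vimage continuous_on_product_coordinates open_discrete)
  ultimately show ?thesis
    by (simp add: open_INT)
qed

text \<open>Supplies the continuous realizer that \<open>cont_name\<close> asks for. By
  \<open>sem_local\<close> every output number is locally constant on the domain.\<close>

lemma continuous_Phi: "continuous_baire (Phi U p)"
  unfolding continuous_baire_def
proof (rule continuous_on_coordinatewise_then_product)
  fix n
  show "continuous_on (dom (Phi U p)) (\<lambda>q. (the \<circ> Phi U p) q n)"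
    unfolding continuous_on_topological
  proof (intro ballI allI impI)
    fix q B assume q: "q \<in> dom (Phi U p)" and B: "(the \<circ> Phi U p) q n \<in> B"
    then obtain r where r: "sem U (pair p q) = Some r"
      by (auto simp: Phi_def)
    obtain N where N: "\<And>p' r'. (\<And>k. k < N \<Longrightarrow> p' k = pair p q k) \<Longrightarrow>
        sem U p' = Some r' \<Longrightarrow> r' n = r n"
      using sem_local[OF r] by blast
    have "(the \<circ> Phi U p) q' n \<in> B"
      if q': "q' \<in> dom (Phi U p)" "\<forall>k<N. q' k = q k" for q'
    proof -
      from q'(1) obtain r' where r': "sem U (pair p q') = Some r'"
        by (auto simp: Phi_def)
      have "pair p q' k = pair p q k" if "k < N" for k
        using that q'(2) by (simp add: pair_def)
      with N r' have "r' n = r n" by blast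
      with B r r' show ?thesis by (simp add: Phi_def)
    qed
    then show "\<exists>A. open A \<and> q \<in> A \<and> (\<forall>q'\<in>dom (Phi U p). q' \<in> A \<longrightarrow> (the \<circ> Phi U p) q' n \<in> B)"
      by (intro exI[of _ "{q'. \<forall>k<N. q' k = q k}"]) (simp add: open_cylinder)
  qed
qed

section \<open>Names of multi-valued functions\<close>

text \<open>Separates definedness, which concerns all names and all cylinder components, from the
  single computation that attains \<open>z\<close>; the latter already shows that \<open>x\<close>
  has a name.\<close>

lemma mem_Phi_multi:
  "z \<in> Phi_multi U \<delta>X \<delta>Y p x \<longleftrightarrow>
     (\<forall>q s. \<delta>X q = Some x \<longrightarrow> (\<exists>r. Phi U p (pair q s) = Some r \<and> r \<in> dom \<delta>Y)) \<and>
     (\<exists>q s r. \<delta>X q = Some x \<and> Phi U p (pair q s) = Some r \<and> \<delta>Y r = Some z)"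
    (is "_ \<longleftrightarrow> ?D \<and> ?E")
proof
  assume z: "z \<in> Phi_multi U \<delta>X \<delta>Y p x"
  then have x: "x \<in> mdom (Phi_multi U \<delta>X \<delta>Y p)"
    by (auto simp: mdom_def)
  then have D: ?D
    by (simp add: mdom_Phi_multi)
  moreover from z obtain q s where qs: "\<delta>X q = Some x" "z = the (\<delta>Y (the (Phi U p (pair q s))))"
    unfolding Phi_multi_eq[OF x] by blast
  ultimately show "?D \<and> ?E"
    by (metis domD option.sel)
next
  assume R: "?D \<and> ?E"
  then have x: "x \<in> mdom (Phi_multi U \<delta>X \<delta>Y p)"
    unfolding mdom_Phi_multi by (blast intro: ranI)
  from R obtain q s r where "\<delta>X q = Some x" "Phi U p (pair q s) = Some r" "\<delta>Y r = Some z"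
    by blast
  then show "z \<in> Phi_multi U \<delta>X \<delta>Y p x"
    unfolding Phi_multi_eq[OF x] by (intro CollectI exI[of _ q] exI[of _ s]) simp
qed

text \<open>Effective traceability without its computability requirement, which the pointwise
  arguments leave aside.\<close>

locale trace =
  fixes \<delta> :: "'a rep" and T :: "baire \<times> baire \<rightharpoonup> baire"
  assumes dom_T: "dom T = dom \<delta> \<times> UNIV"
    and range_T: "\<And>p. p \<in> dom \<delta> \<Longrightarrow> {the (T (p, q)) | q. True} = {r. \<delta> r = \<delta> p}"
begin

lemma trace_sound:
  assumes "T (p, q) = Some r"
  shows "p \<in> dom \<delta> \<and> \<delta> r = \<delta> p"
proof -
  from assms dom_T have p: "p \<in> dom \<delta>" by blast
  have "r \<in> {the (T (p, q)) | q. True}"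
    using assms by (metis (mono_tags, lifting) mem_Collect_eq option.sel)
  with range_T[OF p] p show ?thesis by blast
qed

lemma trace_defined:
  assumes "p \<in> dom \<delta>"
  obtains r where "T (p, q) = Some r"
  using assms dom_T by blast

lemma trace_surj:
  assumes "p \<in> dom \<delta>" "\<delta> r = \<delta> p"
  obtains q where "T (p, q) = Some r"
proof -
  from assms range_T[of p] obtain q where q: "r = the (T (p, q))" by blast
  from trace_defined[OF assms(1)] q that show thesis by (metis option.sel)
qed

end

text \<open>Here \<open>s1\<close> and \<open>s3\<close> are the cylinder components for
  \<open>g\<close> and \<open>f\<close>, while \<open>s2\<close> moves the name found by
  \<open>g\<close> through all names of the same point. The last is essential: membership in the
  domain of \<open>f\<close> is a condition on all names, not only on those that \<open>g\<close>
  produces.\<close>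

lemma Phi_multi_comp:
  assumes "trace \<delta>Y T"
    and v: "\<And>q s1 s2 s3. Phi U v (pair q (pair s1 (pair s2 s3))) =
      Option.bind (Phi U g (pair q s1)) (\<lambda>a. Option.bind (T (a, s2)) (\<lambda>b. Phi U f (pair b s3)))"
  shows "Phi_multi U \<delta>X \<delta>Z v = Phi_multi U \<delta>Y \<delta>Z f \<circ>\<^sub>M Phi_multi U \<delta>X \<delta>Y g"
    (is "?V = ?F \<circ>\<^sub>M ?G")
proof (intro ext set_eqI iffI)
  interpret trace \<delta>Y T by fact
  fix x z
  {
    assume z: "z \<in> ?V x"
    then have D: "\<exists>c. Phi U v (pair q s) = Some c \<and> c \<in> dom \<delta>Z" if "\<delta>X q = Some x" for q s
      using that unfolding mem_Phi_multi by blast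
    have G: "\<exists>a. Phi U g (pair q s) = Some a \<and> a \<in> dom \<delta>Y" if q: "\<delta>X q = Some x" for q s
      using D[OF q, of "pair s (pair s s)"] trace_sound unfolding v by (auto simp: bind_eq_Some_conv)
    \<comment> \<open>Any name \<open>b\<close> of the intermediate point is reached by some
      \<open>s2\<close>, so definedness of \<open>v\<close> passes to \<open>f\<close> on all names
      of that point.\<close>
    have F: "\<exists>c. Phi U f (pair b s) = Some c \<and> c \<in> dom \<delta>Z"
      if q: "\<delta>X q = Some x" and a: "Phi U g (pair q s1) = Some a" and b: "\<delta>Y b = \<delta>Y a" for q s1 a b s
    proof -
      from G[OF q, of s1] a have "a \<in> dom \<delta>Y" by simp
      then obtain s2 where "T (a, s2) = Some b"
        using trace_surj b by blast
      with D[OF q, of "pair s1 (pair s2 s)"] a show ?thesis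
        unfolding v by simp
    qed
    from z obtain q s c where q: "\<delta>X q = Some x" and c: "Phi U v (pair q s) = Some c" "\<delta>Z c = Some z"
      unfolding mem_Phi_multi by blast
    obtain s1 s2 s3 where s: "s = pair s1 (pair s2 s3)"
      by (metis pair_proj)
    from c(1) obtain a b where a: "Phi U g (pair q s1) = Some a" and b: "T (a, s2) = Some b"
      and f: "Phi U f (pair b s3) = Some c"
      unfolding s v by (auto simp: bind_eq_Some_conv)
    from trace_sound[OF b] obtain y where y: "\<delta>Y a = Some y" "\<delta>Y b = Some y"
      by auto
    have yG: "y \<in> ?G x"
      unfolding mem_Phi_multi using G q a y by blast
    have sub: "?G x \<subseteq> mdom ?F"
    proof
      fix y' assume "y' \<in> ?G x"
      then obtain q s a where "\<delta>X q = Some x" "Phi U g (pair q s) = Some a" "\<delta>Y a = Some y'"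
        unfolding mem_Phi_multi by blast
      with F show "y' \<in> mdom ?F"
        unfolding mdom_Phi_multi by (metis ranI)
    qed
    then have "\<exists>r. Phi U f (pair b' s) = Some r \<and> r \<in> dom \<delta>Z" if "\<delta>Y b' = Some y" for b' s
      using yG that by (auto simp: mdom_Phi_multi)
    then have "z \<in> ?F y"
      unfolding mem_Phi_multi using y(2) f c(2) by blast
    with yG sub show "z \<in> (?F \<circ>\<^sub>M ?G) x"
      by (auto simp: mcomp_def mdom_def)
  next
    assume z: "z \<in> (?F \<circ>\<^sub>M ?G) x"
    then obtain y where sub: "?G x \<subseteq> mdom ?F" and y: "y \<in> ?G x" and zF: "z \<in> ?F y"
      by (auto simp: mcomp_def)
    have G: "\<exists>a. Phi U g (pair q s) = Some a \<and> a \<in> dom \<delta>Y" if q: "\<delta>X q = Some x" for q s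
      using y that unfolding mem_Phi_multi by blast
    have D: "\<exists>c. Phi U v (pair q s) = Some c \<and> c \<in> dom \<delta>Z" if q: "\<delta>X q = Some x" for q s
    proof -
      obtain s1 s2 s3 where s: "s = pair s1 (pair s2 s3)"
        by (metis pair_proj)
      from G[OF q] obtain a y' where a: "Phi U g (pair q s1) = Some a" "\<delta>Y a = Some y'"
        by blast
      have "y' \<in> ?G x"
        unfolding mem_Phi_multi using G q a by blast
      with sub have y': "y' \<in> mdom ?F" by blast
      from a(2) obtain b where b: "T (a, s2) = Some b"
        using trace_defined by blast
      with trace_sound a(2) have "\<delta>Y b = Some y'" by simp
      with y' obtain c where "Phi U f (pair b s3) = Some c" "c \<in> dom \<delta>Z"
        unfolding mdom_Phi_multi by blast
      with a b show ?thesis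
        unfolding s v by simp
    qed
    from zF obtain b s3 c where b: "\<delta>Y b = Some y" and c: "Phi U f (pair b s3) = Some c" "\<delta>Z c = Some z"
      unfolding mem_Phi_multi by blast
    from y obtain q s1 a where q: "\<delta>X q = Some x" and a: "Phi U g (pair q s1) = Some a" "\<delta>Y a = Some y"
      unfolding mem_Phi_multi by blast
    \<comment> \<open>\<open>s2\<close> leads from the name \<open>a\<close> computed by
      \<open>g\<close> to the name \<open>b\<close> on which \<open>f\<close> attains
      \<open>z\<close>.\<close>
    from a b obtain s2 where "T (a, s2) = Some b"
      using trace_surj by (metis domI)
    with a c have "Phi U v (pair q (pair s1 (pair s2 s3))) = Some c"
      unfolding v by simp
    with D q c(2) show "z \<in> ?V x"
      unfolding mem_Phi_multi by blast
  }
qed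

text \<open>As \<open>s1\<close> varies, the fixed name \<open>t\<close> yields all names of
  \<open>y\<close>, so the computations for \<open>x\<close> cover all names of the pair. Hence the
  result depends on \<open>y\<close> alone and not on \<open>t\<close>.\<close>

lemma Phi_multi_Curry:
  assumes "trace \<delta>Y T" and t: "\<delta>Y t = Some y"
    and v: "\<And>q s1 s2. Phi U v (pair q (pair s1 s2)) =
      Option.bind (T (t, s1)) (\<lambda>t'. Phi U p (pair (pair t' q) s2))"
  shows "Phi_multi U \<delta>X \<delta>Z v = (\<lambda>x. Phi_multi U (\<delta>Y \<times>\<^sub>r \<delta>X) \<delta>Z p (y, x))"
proof (intro ext set_eqI)
  interpret trace \<delta>Y T by fact
  fix x z
  have name: "(\<delta>Y \<times>\<^sub>r \<delta>X) r = Some (y, x) \<longleftrightarrow>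
      (\<exists>s1 q. r = pair (the (T (t, s1))) q \<and> \<delta>X q = Some x)" for r
  proof
    assume r: "(\<delta>Y \<times>\<^sub>r \<delta>X) r = Some (y, x)"
    then have "\<delta>Y (proj1 r) = Some y" "\<delta>X (proj2 r) = Some x"
      by (auto simp: prod_rep_def split: option.splits)
    moreover from this(1) t obtain s1 where "T (t, s1) = Some (proj1 r)"
      using trace_surj by (metis domI)
    ultimately show "\<exists>s1 q. r = pair (the (T (t, s1))) q \<and> \<delta>X q = Some x"
      by (metis option.sel pair_proj)
  next
    assume "\<exists>s1 q. r = pair (the (T (t, s1))) q \<and> \<delta>X q = Some x"
    then obtain s1 q where r: "r = pair (the (T (t, s1))) q" "\<delta>X q = Some x"
      by blast
    from t obtain t' where "T (t, s1) = Some t'"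
      using trace_defined by blast
    with trace_sound r t show "(\<delta>Y \<times>\<^sub>r \<delta>X) r = Some (y, x)"
      by (simp add: prod_rep_def)
  qed
  define W where "W q s1 s2 = Phi U p (pair (pair (the (T (t, s1))) q) s2)" for q s1 s2
  have W: "Phi U v (pair q s) = W q (proj1 s) (proj2 s)" for q s
  proof -
    from t obtain t' where "T (t, proj1 s) = Some t'"
      using trace_defined by blast
    then show ?thesis
      using v[of q "proj1 s" "proj2 s"] by (simp add: W_def)
  qed
  \<comment> \<open>Pairing is a bijection, so one cylinder component amounts to two independent
    ones.\<close>
  have all: "(\<forall>q s. P q (proj1 s) (proj2 s)) \<longleftrightarrow> (\<forall>q s1 s2. P q s1 s2)"
    and ex: "(\<exists>q s. Q q (proj1 s) (proj2 s)) \<longleftrightarrow> (\<exists>q s1 s2. Q q s1 s2)"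
    for P Q :: "baire \<Rightarrow> baire \<Rightarrow> baire \<Rightarrow> bool"
    by (metis proj_pair)+
  have "z \<in> Phi_multi U \<delta>X \<delta>Z v x \<longleftrightarrow>
      (\<forall>q s1 s2. \<delta>X q = Some x \<longrightarrow> (\<exists>r. W q s1 s2 = Some r \<and> r \<in> dom \<delta>Z)) \<and>
      (\<exists>q s1 s2. \<exists>r. \<delta>X q = Some x \<and> W q s1 s2 = Some r \<and> \<delta>Z r = Some z)"
    unfolding mem_Phi_multi W by (intro arg_cong2[where f = "(\<and>)"] all ex)
  also have "\<dots> \<longleftrightarrow> z \<in> Phi_multi U (\<delta>Y \<times>\<^sub>r \<delta>X) \<delta>Z p (y, x)"
    unfolding mem_Phi_multi name W_def by blast
  finally show "z \<in> Phi_multi U \<delta>X \<delta>Z v x \<longleftrightarrow> z \<in> Phi_multi U (\<delta>Y \<times>\<^sub>r \<delta>X) \<delta>Z p (y, x)" .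
qed

text \<open>The s-m-n property: a computable partial function of two arguments becomes a computable
  translation of the first argument into names, with equality of domains.\<close>

lemma universalE:
  assumes "universal U" "computable_baire H"
  obtains S where "computable_baire (\<lambda>p. Some (S p))" "\<And>p q. Phi U (S p) q = H (pair p q)"
  using assms unfolding universal_def computable_baire_def Phi_def by metis

theorem proposition7p9:
  fixes U :: machine
    and \<delta>X :: "'x rep" and \<delta>Y :: "'y rep" and \<delta>Z :: "'z rep"
  assumes "universal U"
    and "effectively_traceable \<delta>Y"
  shows "computable_multi (M_rep U \<delta>Y \<delta>Z \<times>\<^sub>r M_rep U \<delta>X \<delta>Y) (M_rep U \<delta>X \<delta>Z)
             (mv (\<lambda>(f, g). Some (f \<circ>\<^sub>M g)))
       \<and> computable_multi (M_rep U (\<delta>Y \<times>\<^sub>r \<delta>X) \<delta>Z) (C_rep U \<delta>Y (M_rep U \<delta>X \<delta>Z))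
             (mv (\<lambda>f. Some (Curry \<delta>Y f)))"
proof -
  obtain T where T: "computable_baire (\<lambda>r. T (proj1 r, proj2 r))" and trace: "trace \<delta>Y T"
    using assms(2) unfolding effectively_traceable_def trace_def by blast
  \<comment> \<open>Access paths into the input \<open>u\<close>. For composition it has the form
    \<open>pair (pair f g) (pair q (pair s1 (pair s2 s3)))\<close>, for currying
    \<open>pair (pair p t) (pair q (pair s1 s2))\<close>.\<close>
  have proj: "computable_baire (\<lambda>u. Some (proj1 (proj1 u)))"
    "computable_baire (\<lambda>u. Some (proj2 (proj1 u)))"
    "computable_baire (\<lambda>u. Some (proj1 (proj2 u)))"
    "computable_baire (\<lambda>u. Some (proj1 (proj2 (proj2 u))))"
    "computable_baire (\<lambda>u. Some (proj2 (proj2 (proj2 u))))"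
    "computable_baire (\<lambda>u. Some (proj1 (proj2 (proj2 (proj2 u)))))"
    "computable_baire (\<lambda>u. Some (proj2 (proj2 (proj2 (proj2 u)))))"
    by (intro computable_proj computable_id)+
  show ?thesis
  proof
    \<comment> \<open>\<open>G\<close> runs the name of the inner function on
      \<open>pair q s1\<close>, \<open>B\<close> moves the result by \<open>s2\<close> and attaches
      \<open>s3\<close>, and \<open>H\<close> runs the name of the outer function on that.\<close>
    note G = computable_app[OF computable_sem
        computable_total_pair[OF proj(2) computable_total_pair[OF proj(3,4)]], of U]
    note B = computable_bind_pair_left[OF computable_id
        computable_bind_pair_left[OF T G proj(6)] proj(7)]
    note H = computable_bind_pair_right[OF computable_sem[of U] proj(1) B]
    obtain S where S: "computable_baire (\<lambda>p. Some (S p))"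
      and v: "\<And>r q s1 s2 s3. Phi U (S r) (pair q (pair s1 (pair s2 s3))) =
        Option.bind (Phi U (proj2 r) (pair q s1))
          (\<lambda>a. Option.bind (T (a, s2)) (\<lambda>b. Phi U (proj1 r) (pair b s3)))"
      by (rule universalE[OF assms(1) H]) (simp add: Phi_def)
    have "Phi_multi U \<delta>X \<delta>Z (S r)
        = Phi_multi U \<delta>Y \<delta>Z (proj1 r) \<circ>\<^sub>M Phi_multi U \<delta>X \<delta>Y (proj2 r)" for r
      by (rule Phi_multi_comp[OF trace v])
    then have "realizes (M_rep U \<delta>Y \<delta>Z \<times>\<^sub>r M_rep U \<delta>X \<delta>Y) (M_rep U \<delta>X \<delta>Z) (\<lambda>p. Some (S p))
        (mv (\<lambda>(f, g). Some (f \<circ>\<^sub>M g)))"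
      by (auto simp: realizes_def M_rep_def prod_rep_def mv_def)
    with S show "computable_multi (M_rep U \<delta>Y \<delta>Z \<times>\<^sub>r M_rep U \<delta>X \<delta>Y) (M_rep U \<delta>X \<delta>Z)
        (mv (\<lambda>(f, g). Some (f \<circ>\<^sub>M g)))"
      unfolding computable_multi_def by blast
  next
    \<comment> \<open>\<open>C\<close> computes \<open>pair (pair (T (t, s1)) q) s2\<close> wherever
      the trace is defined, and \<open>H\<close> runs \<open>p\<close> on it.\<close>
    note C = computable_bind_pair_left[OF computable_id
        computable_bind_pair_left[OF computable_id
          computable_bind_pair_left[OF T proj(2,4)] proj(3)] proj(5)]
    note H = computable_bind_pair_right[OF computable_sem[of U] proj(1) C]
    obtain S where S: "computable_baire (\<lambda>p. Some (S p))"
      and v: "\<And>p t q s1 s2. Phi U (S (pair p t)) (pair q (pair s1 s2)) =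
        Option.bind (T (t, s1)) (\<lambda>t'. Phi U p (pair (pair t' q) s2))"
      by (rule universalE[OF assms(1) H]) (simp add: Phi_def)
    \<comment> \<open>Universality is used a second time: \<open>S (pair p t)\<close> names the
      section at the point named by \<open>t\<close>, and \<open>R p\<close> names the passage from
      \<open>t\<close> to that section.\<close>
    obtain R where R: "computable_baire (\<lambda>p. Some (R p))" "\<And>p q. Phi U (R p) q = Some (S (pair p q))"
      using universalE[OF assms(1) S] by blast
    have eq: "Phi_multi U \<delta>X \<delta>Z (S (pair p t)) = (\<lambda>x. Phi_multi U (\<delta>Y \<times>\<^sub>r \<delta>X) \<delta>Z p (y, x))"
      if "\<delta>Y t = Some y" for p t y
      by (rule Phi_multi_Curry[OF trace that v])
    have "cont_name U \<delta>Y (M_rep U \<delta>X \<delta>Z) (R p) (Curry \<delta>Y (Phi_multi U (\<delta>Y \<times>\<^sub>r \<delta>X) \<delta>Z p))"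
      (is "cont_name _ _ ?\<mu> _ ?C") for p
    proof -
      have r: "realizes \<delta>Y ?\<mu> (Phi U (R p)) (mv ?C)"
        by (auto simp: realizes_def R(2) M_rep_def mv_def Curry_def eq ranI)
      have "ran ?C \<subseteq> ran ?\<mu>"
      proof
        fix h assume "h \<in> ran ?C"
        then obtain y t where "\<delta>Y t = Some y" "h = (\<lambda>x. Phi_multi U (\<delta>Y \<times>\<^sub>r \<delta>X) \<delta>Z p (y, x))"
          by (auto simp: ran_def Curry_def split: if_splits)
        then have "?\<mu> (S (pair p t)) = Some h"
          by (simp add: M_rep_def eq)
        then show "h \<in> ran ?\<mu>" by (auto simp: ran_def)
      qed
      moreover have "dom ?C = ran \<delta>Y"
        by (auto simp: Curry_def split: if_splits)
      \<comment> \<open>\<open>Phi U (R p)\<close> is at once the named realizer and a continuous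
        one.\<close>
      ultimately show ?thesis
        using r continuous_Phi unfolding cont_name_def continuous_multi_def by blast
    qed
    then have "realizes (M_rep U (\<delta>Y \<times>\<^sub>r \<delta>X) \<delta>Z) (C_rep U \<delta>Y (M_rep U \<delta>X \<delta>Z))
        (\<lambda>p. Some (R p)) (mv (\<lambda>f. Some (Curry \<delta>Y f)))"
      by (auto simp: realizes_def M_rep_def mv_def C_rep_eq_Some)
    with R(1) show "computable_multi (M_rep U (\<delta>Y \<times>\<^sub>r \<delta>X) \<delta>Z) (C_rep U \<delta>Y (M_rep U \<delta>X \<delta>Z))
        (mv (\<lambda>f. Some (Curry \<delta>Y f)))"
      unfolding computable_multi_def by blast
  qed
qed

end
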